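(* In the splitting scheme there is a constant $c$, independent of $n$ and $\tau$, such that for every $n$, $\mathcal K(\sigma^{n+1/2})\le\mathcal K(\sigma^n)+c\tau$.
   Context: Setting. $\Omega\subset\mathbb R$ is a bounded open interval and $T>0$. $BV(\Omega)$ is the space of functions $f:\bar\Omega\to\mathbb R$ with finite total variation $|f|_{BV}:=\sup_P\sum_{i=1}^{|P|-1}|f(x_{i+1})-f(x_i)|$, the supremum over finite partitions $P=\{x_1<\dots<x_{|P|}\}\subset\Omega$. A function $\chi:[0,\infty)\to\mathbb R$ is an internal energy density: $\chi\in C^0([0,\infty))\cap C^2((0,\infty))$, $\chi''>0$ on $(0,\infty)$, $\lim_{h\downarrow0}\chi'(h)=0$, and the integrals $\kappa(x):=\int_1^x\frac{\chi''(s)}{s}\,ds$ and $K(\sigma):=\int_0^\sigma\kappa(x)\,dx$ exist. Put $\mathcal K(\sigma):=\int_\Omega K(\sigma)\,dx$ and $\mathcal E(\rho,\eta):=\int_\Omega\chi(\rho+\eta)\,dx$. The functions $F_1,F_2,G_1,G_2:[0,\infty)^2\to\mathbb R$ are bounded and Lipschitz, with $G_1(0,\eta)\ge0$ for all $\eta\ge0$ and $G_2(\rho,0)\ge0$ for all $\rho\ge0$. For $\sigma\ge0$, $r\in[0,1]$ set $\tilde F_i(\sigma,r)=F_i(r\sigma,(1-r)\sigma)$, $\tilde G_i(\sigma,r)=G_i(r\sigma,(1-r)\sigma)$, $A_1=\tilde F_1+\tilde G_2$, $A_2=\tilde G_1+\tilde F_2$, $A_3=\tilde F_1-\tilde F_2$,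 $\Sigma(\sigma,r)=\sigma(rA_1+(1-r)A_2)$, $R(\sigma,r)=r(1-r)A_3+(1-r)^2\tilde G_1-r^2\tilde G_2$. Initial data: $\rho_0,\eta_0\in BV(\Omega)\cap L^\infty(\Omega)$ nonnegative, $\sigma_0=\rho_0+\eta_0$, and $r_0\in BV(\Omega)$ with $0\le r_0\le1$ and $r_0=\rho_0/\sigma_0$ on $\{\sigma_0>0\}$. For $m>0$, $\mathcal P^m(\Omega)$ is the set of nonnegative Borel measures on $\Omega$ of total mass $m$; $W_p$ ($p=1,2$) is the $p$-Wasserstein distance between measures of equal mass, $W_p^p(\mu,\nu)=\inf_\gamma\int|x-y|^p\,d\gamma$ over couplings $\gamma$ of $\mu,\nu$. Splitting scheme. Fix $\tau\in(0,1)$ and $N\in\mathbb N$ with $N\tau=T$; set $r^0=r_0$, $\sigma^0=\sigma_0$. For $n=0,\dots,N-1$: (Reaction step) for each $x\in\Omega$ solve $\dot\sigma=\Sigma(\sigma,r)$, $\dot r=R(\sigma,r)$ on $[0,\tau]$ with $\sigma(0)=\sigma^n(x)$, $r(0)=r^n(x)$, and set $\sigma^{n+1/2}(x)=\sigma(\tau)$, $r^{n+1/2}(x)=r(\tau)$, $\rho^{n+1/2}=r^{n+1/2}\sigma^{n+1/2}$, $\eta^{n+1/2}=(1-r^{n+1/2})\sigma^{n+1/2}$, $U^{n+1/2}=(\rho^{n+1/2},\eta^{n+1/2})$. (Diffusion step) with $m_1=\int_\Omega\rho^{n+1/2}$, $m_2=\int_\Omega\eta^{n+1/2}$, let $U^{n+1}=(\rho^{n+1},\eta^{n+1})$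 be a minimiser over $(\rho,\eta)\in\mathcal P^{m_1}(\Omega)\times\mathcal P^{m_2}(\Omega)$ of $\frac1{2\tau}\big[W_2^2(\rho,\rho^{n+1/2})+W_2^2(\eta,\eta^{n+1/2})\big]+\mathcal E(\rho,\eta)$; set $\sigma^{n+1}=\rho^{n+1}+\eta^{n+1}$ and $r^{n+1}=r^{n+1/2}\circ\mathcal T$, where $\mathcal T$ is the nondecreasing optimal transport map pushing $\sigma^{n+1}$ forward to $\sigma^{n+1/2}$. Also $\rho^n=r^n\sigma^n$, $\eta^n=(1-r^n)\sigma^n$, $U^n=(\rho^n,\eta^n)$. Piecewise constant interpolation: for $t\in[n\tau,(n+1)\tau)$, $r_\tau(t)=r^n$, $\sigma_\tau(t)=\sigma^n$, $\rho_\tau(t)=r^n\sigma^n$, $\eta_\tau(t)=(1-r^n)\sigma^n$, $U_\tau=(\rho_\tau,\eta_\tau)$. *)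

theory Defs
  imports "HOL-Probability.Probability"
begin

text \<open>kappa(x) = int_1^x chi''(s)/s ds (oriented interval integral), where ddchi stands for chi''.\<close>
definition kappa :: "(real \<Rightarrow> real) \<Rightarrow> real \<Rightarrow> real" where
  "kappa ddchi x = interval_lebesgue_integral lborel 1 (ereal x) (\<lambda>s. ddchi s / s)"

definition Kfun :: "(real \<Rightarrow> real) \<Rightarrow> real \<Rightarrow> real" where
  "Kfun ddchi \<sigma> = interval_lebesgue_integral lborel 0 (ereal \<sigma>) (kappa ddchi)"

definition Kcal :: "real set \<Rightarrow> (real \<Rightarrow> real) \<Rightarrow> (real \<Rightarrow> real) \<Rightarrow> real" where
  "Kcal \<Omega> ddchi \<sigma> = (LINT x:\<Omega>|lborel. Kfun ddchi (\<sigma> x))"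

definition bv_var :: "real set \<Rightarrow> (real \<Rightarrow> real) \<Rightarrow> ereal" where
  "bv_var \<Omega> f = (SUP xs \<in> {xs. sorted_wrt (<) xs \<and> set xs \<subseteq> \<Omega>}.
      ereal (\<Sum>i<length xs - 1. \<bar>f (xs ! Suc i) - f (xs ! i)\<bar>))"

definition BV :: "real set \<Rightarrow> (real \<Rightarrow> real) \<Rightarrow> bool" where
  "BV \<Omega> f \<longleftrightarrow> bv_var \<Omega> f < \<infinity>"

definition til :: "(real \<Rightarrow> real \<Rightarrow> real) \<Rightarrow> real \<Rightarrow> real \<Rightarrow> real" where
  "til F \<sigma> r = F (r * \<sigma>) ((1 - r) * \<sigma>)"

definition SigmaR :: "(real \<Rightarrow> real \<Rightarrow> real) \<Rightarrow> (real \<Rightarrow> real \<Rightarrow> real) \<Rightarrow>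
    (real \<Rightarrow> real \<Rightarrow> real) \<Rightarrow> (real \<Rightarrow> real \<Rightarrow> real) \<Rightarrow> real \<Rightarrow> real \<Rightarrow> real" where
  "SigmaR F1 F2 G1 G2 \<sigma> r =
     \<sigma> * (r * (til F1 \<sigma> r + til G2 \<sigma> r) + (1 - r) * (til G1 \<sigma> r + til F2 \<sigma> r))"

definition Rfun :: "(real \<Rightarrow> real \<Rightarrow> real) \<Rightarrow> (real \<Rightarrow> real \<Rightarrow> real) \<Rightarrow>
    (real \<Rightarrow> real \<Rightarrow> real) \<Rightarrow> (real \<Rightarrow> real \<Rightarrow> real) \<Rightarrow> real \<Rightarrow> real \<Rightarrow> real" where
  "Rfun F1 F2 G1 G2 \<sigma> r =
     r * (1 - r) * (til F1 \<sigma> r - til F2 \<sigma> r) + (1 - r)^2 * til G1 \<sigma> r - r^2 * til G2 \<sigma> r"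

definition LOm :: "real set \<Rightarrow> real measure" where
  "LOm \<Omega> = restrict_space lborel \<Omega>"

definition meas_on :: "real set \<Rightarrow> ennreal \<Rightarrow> real measure set" where
  "meas_on \<Omega> m = {\<mu>. sets \<mu> = sets (LOm \<Omega>) \<and> emeasure \<mu> \<Omega> = m}"

definition couplings :: "real set \<Rightarrow> real measure \<Rightarrow> real measure \<Rightarrow> (real \<times> real) measure set" where
  "couplings \<Omega> \<mu> \<nu> = {\<gamma>. sets \<gamma> = sets (LOm \<Omega> \<Otimes>\<^sub>M LOm \<Omega>) \<and>
      distr \<gamma> (LOm \<Omega>) fst = \<mu> \<and> distr \<gamma> (LOm \<Omega>) snd = \<nu>}"

definition W2sq :: "real set \<Rightarrow> real measure \<Rightarrow> real measure \<Rightarrow> ennreal" where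
  "W2sq \<Omega> \<mu> \<nu> = (INF \<gamma> \<in> couplings \<Omega> \<mu> \<nu>. \<integral>\<^sup>+ z. ennreal ((fst z - snd z)^2) \<partial>\<gamma>)"

definition dens :: "real set \<Rightarrow> (real \<Rightarrow> real) \<Rightarrow> real measure" where
  "dens \<Omega> f = density (LOm \<Omega>) (\<lambda>x. ennreal (f x))"

text \<open>E(rho,eta) = int_Omega chi(rho+eta) dx for absolutely continuous measures (written as
  chi(0)|Omega| + int (chi(rho+eta) - chi(0)), the integrand being nonnegative since chi is
  nondecreasing), and +infinity otherwise.\<close>
definition energy :: "real set \<Rightarrow> (real \<Rightarrow> real) \<Rightarrow> real measure \<Rightarrow> real measure \<Rightarrow> ereal" where
  "energy \<Omega> chi \<mu> \<nu> =
     (if absolutely_continuous (LOm \<Omega>) \<mu> \<and> absolutely_continuous (LOm \<Omega>) \<nu>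
      then ereal (chi 0 * measure lborel \<Omega>) +
        enn2ereal (\<integral>\<^sup>+ x \<in> \<Omega>. ennreal (chi (enn2real (RN_deriv (LOm \<Omega>) \<mu> x)
                                        + enn2real (RN_deriv (LOm \<Omega>) \<nu> x)) - chi 0) \<partial>lborel)
      else \<infinity>)"

definition jko :: "real set \<Rightarrow> (real \<Rightarrow> real) \<Rightarrow> real \<Rightarrow> real measure \<Rightarrow> real measure \<Rightarrow>
    real measure \<Rightarrow> real measure \<Rightarrow> ereal" where
  "jko \<Omega> chi \<tau> \<mu>0 \<nu>0 \<mu> \<nu> =
     ereal (1 / (2 * \<tau>)) * enn2ereal (W2sq \<Omega> \<mu> \<mu>0 + W2sq \<Omega> \<nu> \<nu>0) + energy \<Omega> chi \<mu> \<nu>"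

text \<open>sig n = sigma^n, r n = r^n, sigh n = sigma^{n+1/2}, rh n = r^{n+1/2}.\<close>
definition splitting_scheme ::
  "real set \<Rightarrow> (real \<Rightarrow> real) \<Rightarrow> (real \<Rightarrow> real \<Rightarrow> real) \<Rightarrow> (real \<Rightarrow> real \<Rightarrow> real) \<Rightarrow>
   (real \<Rightarrow> real \<Rightarrow> real) \<Rightarrow> (real \<Rightarrow> real \<Rightarrow> real) \<Rightarrow> (real \<Rightarrow> real) \<Rightarrow> (real \<Rightarrow> real) \<Rightarrow>
   real \<Rightarrow> nat \<Rightarrow> (nat \<Rightarrow> real \<Rightarrow> real) \<Rightarrow> (nat \<Rightarrow> real \<Rightarrow> real) \<Rightarrow>
   (nat \<Rightarrow> real \<Rightarrow> real) \<Rightarrow> (nat \<Rightarrow> real \<Rightarrow> real) \<Rightarrow> bool" where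
  "splitting_scheme \<Omega> chi F1 F2 G1 G2 \<sigma>0 r0 \<tau> N sig r sigh rh \<longleftrightarrow>
     sig 0 = \<sigma>0 \<and> r 0 = r0 \<and>
     \<comment> \<open>reaction step\<close>
     (\<forall>n<N. \<forall>x\<in>\<Omega>. \<exists>s q :: real \<Rightarrow> real.
        s 0 = sig n x \<and> q 0 = r n x \<and>
        (\<forall>t\<in>{0..\<tau>}. 0 \<le> s t \<and> 0 \<le> q t \<and> q t \<le> 1 \<and>
           (s has_real_derivative SigmaR F1 F2 G1 G2 (s t) (q t)) (at t within {0..\<tau>}) \<and>
           (q has_real_derivative Rfun F1 F2 G1 G2 (s t) (q t)) (at t within {0..\<tau>})) \<and>
        sigh n x = s \<tau> \<and> rh n x = q \<tau>) \<and>
     \<comment> \<open>diffusion step\<close>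
     (\<forall>n<N. \<exists>rho eta :: real \<Rightarrow> real.
        rho \<in> borel_measurable borel \<and> eta \<in> borel_measurable borel \<and>
        (\<forall>x\<in>\<Omega>. 0 \<le> rho x \<and> 0 \<le> eta x) \<and>
        (let m1 = (\<integral>\<^sup>+ x \<in> \<Omega>. ennreal (rh n x * sigh n x) \<partial>lborel);
             m2 = (\<integral>\<^sup>+ x \<in> \<Omega>. ennreal ((1 - rh n x) * sigh n x) \<partial>lborel);
             \<mu>h = dens \<Omega> (\<lambda>x. rh n x * sigh n x);
             \<nu>h = dens \<Omega> (\<lambda>x. (1 - rh n x) * sigh n x)
         in dens \<Omega> rho \<in> meas_on \<Omega> m1 \<and> dens \<Omega> eta \<in> meas_on \<Omega> m2 \<and>
            (\<forall>\<mu>\<in>meas_on \<Omega> m1. \<forall>\<nu>\<in>meas_on \<Omega> m2.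
               jko \<Omega> chi \<tau> \<mu>h \<nu>h (dens \<Omega> rho) (dens \<Omega> eta) \<le> jko \<Omega> chi \<tau> \<mu>h \<nu>h \<mu> \<nu>)) \<and>
        (\<forall>x\<in>\<Omega>. sig (Suc n) x = rho x + eta x) \<and>
        (\<exists>T. T \<in> measurable (LOm \<Omega>) (LOm \<Omega>) \<and> T ` \<Omega> \<subseteq> \<Omega> \<and> mono_on \<Omega> T \<and>
             distr (dens \<Omega> (sig (Suc n))) (LOm \<Omega>) T = dens \<Omega> (sigh n) \<and>
             (\<integral>\<^sup>+ x. ennreal ((x - T x)^2) \<partial>dens \<Omega> (sig (Suc n)))
                = W2sq \<Omega> (dens \<Omega> (sig (Suc n))) (dens \<Omega> (sigh n)) \<and>
             (\<forall>x\<in>\<Omega>. r (Suc n) x = rh n (T x))))"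

end

theory Submission
  imports Defs
begin

text \<open>
  Along the reaction flow \<open>d/dt K(\<sigma>) = \<kappa>(\<sigma>) \<sigma> (r A\<^sub>1 + (1 - r) A\<^sub>2)\<close>, and \<open>\<sigma> \<kappa>(\<sigma>)\<close> is bounded on every
  interval \<open>(0, S]\<close>, so everything rests on an \<open>L\<^sup>\<infinity>\<close> bound for \<open>\<sigma>\<^sup>n\<close> that is uniform in \<open>n\<close> and \<open>\<tau>\<close>.
  The reaction step increases the supremum at most by the factor \<open>exp (2 B \<tau>)\<close>, where \<open>B\<close> bounds the rates. The diffusion step
  does not increase it: if \<open>\<sigma>\<^sup>n\<^sup>+\<^sup>1\<close> exceeded \<open>M = sup \<sigma>\<^sup>n\<^sup>+\<^sup>\<onehalf>\<close> on a set \<open>A\<close> of positive measure, the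
  optimal map \<open>T\<close> would send some of the mass in \<open>A\<close> to the complement of \<open>A\<close>. Moving a fraction \<open>\<epsilon>\<close> of that mass
  to its image under \<open>T\<close> lowers the transport cost by a quantity of order \<open>\<epsilon>\<close>, whereas the internal
  energy grows at most by \<open>\<epsilon> m (\<chi>'((1 + \<epsilon>) M) - \<chi>'((1 - \<epsilon>) M)) = o(\<epsilon>)\<close>, which contradicts minimality.
  Both species are transported by the same \<open>T\<close>, since \<open>(r\<^sup>n\<^sup>+\<^sup>\<onehalf> \<circ> T) \<sigma>\<^sup>n\<^sup>+\<^sup>1\<close> and
  \<open>(1 - r\<^sup>n\<^sup>+\<^sup>\<onehalf> \<circ> T) \<sigma>\<^sup>n\<^sup>+\<^sup>1\<close> have the same total energy and no larger transport cost than the minimiser.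
\<close>

section \<open>Measurability of functions of bounded variation\<close>

lemma BV_borel_measurable:
  assumes "BV \<Omega> f"
  shows "f \<in> borel_measurable (restrict_space borel \<Omega>)"
proof -
  define var where "var xs = (\<Sum>i<length xs - 1. \<bar>f (xs ! Suc i) - f (xs ! i)\<bar>)" for xs :: "real list"
  define P where "P x = {xs. sorted_wrt (<) (xs @ [x]) \<and> set (xs @ [x]) \<subseteq> \<Omega>}" for x
  define V where "V x = (SUP xs\<in>P x. var (xs @ [x]))" for x
  obtain B where B: "bv_var \<Omega> f \<le> ereal B"
    using assms unfolding BV_def by (cases "bv_var \<Omega> f") auto
  have varB: "var xs \<le> B" if "sorted_wrt (<) xs" "set xs \<subseteq> \<Omega>" for xs
  proof -
    have "ereal (var xs) \<le> bv_var \<Omega> f"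
      unfolding bv_var_def var_def using that by (intro SUP_upper) auto
    then show ?thesis using B by (metis ereal_less_eq(3) order_trans)
  qed
  have bdd: "bdd_above ((\<lambda>xs. var (xs @ [x])) ` P x)" for x
    using varB by (intro bdd_aboveI[of _ B]) (auto simp: P_def)
  have snoc: "var ((xs @ [x]) @ [y]) = var (xs @ [x]) + \<bar>f y - f x\<bar>" for xs x y
  proof -
    have "var ((xs @ [x]) @ [y]) = (\<Sum>i<Suc (length xs). \<bar>f (((xs @ [x]) @ [y]) ! Suc i) - f (((xs @ [x]) @ [y]) ! i)\<bar>)"
      by (simp add: var_def)
    also have "\<dots> = (\<Sum>i<length xs. \<bar>f (((xs @ [x]) @ [y]) ! Suc i) - f (((xs @ [x]) @ [y]) ! i)\<bar>) + \<bar>f y - f x\<bar>"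
      by (simp add: nth_append)
    also have "(\<Sum>i<length xs. \<bar>f (((xs @ [x]) @ [y]) ! Suc i) - f (((xs @ [x]) @ [y]) ! i)\<bar>) = var (xs @ [x])"
      unfolding var_def by (rule sum.cong) (auto simp: nth_append)
    finally show ?thesis .
  qed
  have step: "V x + \<bar>f y - f x\<bar> \<le> V y" if "x \<in> \<Omega>" "y \<in> \<Omega>" "x < y" for x y
  proof -
    have "V x \<le> V y - \<bar>f y - f x\<bar>"
      unfolding V_def[of x]
    proof (rule cSUP_least)
      show "P x \<noteq> {}" using that by (auto simp: P_def intro!: exI[of _ "[]"])
      fix xs assume xs: "xs \<in> P x"
      then have "xs @ [x] \<in> P y"
        using that by (fastforce simp: P_def sorted_wrt_append)
      then have "var ((xs @ [x]) @ [y]) \<le> V y"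
        unfolding V_def by (rule cSUP_upper[OF _ bdd])
      then show "var (xs @ [x]) \<le> V y - \<bar>f y - f x\<bar>" by (simp only: snoc)
    qed
    then show ?thesis by simp
  qed
  have "mono_on \<Omega> V" "mono_on \<Omega> (\<lambda>x. V x - f x)"
    using step by (fastforce simp: monotone_on_def le_less)+
  then have "V \<in> borel_measurable (restrict_space borel \<Omega>)"
    "(\<lambda>x. V x - f x) \<in> borel_measurable (restrict_space borel \<Omega>)"
    by (auto intro: borel_measurable_mono_on_fnc)
  then have "(\<lambda>x. V x - (V x - f x)) \<in> borel_measurable (restrict_space borel \<Omega>)"
    by (rule borel_measurable_diff)
  then show ?thesis by simp
qed

section \<open>Sums of measures and transport costs\<close>

definition madd :: "'a measure \<Rightarrow> 'a measure \<Rightarrow> 'a measure" where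
  "madd M N = measure_of (space M) (sets M) (\<lambda>A. emeasure M A + emeasure N A)"

lemma sets_madd [simp, measurable_cong]: "sets (madd M N) = sets M"
  and space_madd [simp]: "space (madd M N) = space M"
  by (simp_all add: madd_def)

lemma emeasure_madd:
  assumes "sets N = sets M"
  shows "emeasure (madd M N) A = emeasure M A + emeasure N A"
proof (cases "A \<in> sets M")
  case True
  have "countably_additive (sets M) (\<lambda>A. emeasure M A + emeasure N A)"
    unfolding countably_additive_def
  proof safe
    fix B :: "nat \<Rightarrow> 'a set"
    assume B: "range B \<subseteq> sets M" "disjoint_family B"
    have "(\<Sum>i. emeasure M (B i) + emeasure N (B i)) = (\<Sum>i. emeasure M (B i)) + (\<Sum>i. emeasure N (B i))"
      by (rule suminf_add[symmetric]) auto
    also have "\<dots> = emeasure M (\<Union>i. B i) + emeasure N (\<Union>i. B i)"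
      using B assms by (simp add: suminf_emeasure)
    finally show "(\<Sum>i. emeasure M (B i) + emeasure N (B i)) = emeasure M (\<Union> (range B)) + emeasure N (\<Union> (range B))" .
  qed
  then show ?thesis
    unfolding madd_def using True
    by (intro emeasure_measure_of_sigma) (auto simp: sets.sigma_algebra_axioms positive_def)
next
  case False
  then show ?thesis using assms by (simp add: emeasure_notin_sets)
qed

lemma nn_integral_madd:
  assumes N: "sets N = sets M" and f: "f \<in> borel_measurable M"
  shows "(\<integral>\<^sup>+x. f x \<partial>madd M N) = (\<integral>\<^sup>+x. f x \<partial>M) + (\<integral>\<^sup>+x. f x \<partial>N)"
  using f
proof (induction rule: borel_measurable_induct)
  case (cong f g)
  then show ?case
    using sets_eq_imp_space_eq[OF N]
      nn_integral_cong[of M f g] nn_integral_cong[of N f g] nn_integral_cong[of "madd M N" f g] by simp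
next
  case (set A)
  then show ?case using N by (simp add: emeasure_madd)
next
  case (mult u c)
  have "u \<in> borel_measurable N" using mult N measurable_cong_sets by blast
  then show ?case using mult
    by (simp add: nn_integral_cmult distrib_left)
next
  case (add u v)
  have "u \<in> borel_measurable N" "v \<in> borel_measurable N" using add N measurable_cong_sets by blast+
  then show ?case using add
    by (simp add: nn_integral_add ac_simps)
next
  case (seq U)
  have U: "U i \<in> borel_measurable N" "U i \<in> borel_measurable (madd M N)" for i
    using seq(1)[of i] N measurable_cong_sets by (blast, simp)
  have inc: "incseq (\<lambda>i. \<integral>\<^sup>+x. U i x \<partial>Q)" for Q
    using \<open>incseq U\<close> by (auto simp: incseq_def le_fun_def intro!: nn_integral_mono)
  have "(\<integral>\<^sup>+x. (SUP i. U i) x \<partial>madd M N) = (SUP i. \<integral>\<^sup>+x. U i x \<partial>madd M N)"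
    using nn_integral_monotone_convergence_SUP[OF \<open>incseq U\<close> U(2)] by (simp add: image_comp)
  also have "\<dots> = (SUP i. (\<integral>\<^sup>+x. U i x \<partial>M) + (\<integral>\<^sup>+x. U i x \<partial>N))"
    using seq by simp
  also have "\<dots> = (SUP i. (\<integral>\<^sup>+x. U i x \<partial>M)) + (SUP i. (\<integral>\<^sup>+x. U i x \<partial>N))"
    by (rule ennreal_SUP_add[OF inc inc])
  also have "\<dots> = (\<integral>\<^sup>+x. (SUP i. U i) x \<partial>M) + (\<integral>\<^sup>+x. (SUP i. U i) x \<partial>N)"
    using nn_integral_monotone_convergence_SUP[OF \<open>incseq U\<close> seq(1)]
      nn_integral_monotone_convergence_SUP[OF \<open>incseq U\<close> U(1)] by (simp add: image_comp)
  finally show ?case .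
qed

lemma distr_madd:
  assumes N: "sets N = sets M" and f: "f \<in> measurable M L"
  shows "distr (madd M N) L f = madd (distr M L f) (distr N L f)"
proof (rule measure_eqI)
  fix A assume A: "A \<in> sets (distr (madd M N) L f)"
  have fN: "f \<in> measurable N L" using f N measurable_cong_sets by blast
  have f': "f \<in> measurable (madd M N) L" using f by simp
  show "emeasure (distr (madd M N) L f) A = emeasure (madd (distr M L f) (distr N L f)) A"
    using A f fN f' N sets_eq_imp_space_eq[OF N] by (simp add: emeasure_distr emeasure_madd)
qed simp

lemma madd_density:
  assumes [measurable]: "f \<in> borel_measurable M" "g \<in> borel_measurable M"
  shows "madd (density M f) (density M g) = density M (\<lambda>x. f x + g x)"
  by (rule measure_eqI) (auto simp: emeasure_madd emeasure_density nn_integral_add distrib_right)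

lemma le_INF_add_INF_ennreal:
  fixes a :: ennreal
  assumes "\<And>x y. x \<in> A \<Longrightarrow> y \<in> B \<Longrightarrow> a \<le> f x + g y"
  shows "a \<le> (INF x\<in>A. f x) + (INF y\<in>B. g y)"
proof -
  have 1: "b \<le> c + (INF y\<in>B. h y)" if "\<And>y. y \<in> B \<Longrightarrow> b \<le> c + h y"
    for b c :: ennreal and B and h :: "'z \<Rightarrow> ennreal"
  proof (cases "c = top")
    case False
    then have "b - c \<le> h y" if "y \<in> B" for y
      using \<open>\<And>y. y \<in> B \<Longrightarrow> b \<le> c + h y\<close>[OF that] by (simp add: ennreal_minus_le_iff)
    then have "b - c \<le> (INF y\<in>B. h y)" by (rule INF_greatest)
    then show ?thesis by (simp add: ennreal_minus_le_iff)
  qed simp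
  have "a \<le> f x + (INF y\<in>B. g y)" if "x \<in> A" for x
    using assms that by (intro 1) auto
  then show ?thesis using 1[of A a "INF y\<in>B. g y" f] by (simp add: add.commute)
qed

lemma borel_measurable_LOm_ident: "(\<lambda>x. x) \<in> borel_measurable (LOm \<Omega>)"
  unfolding LOm_def by (rule measurable_restrict_space1) simp

lemma W2sq_madd_le:
  assumes "sets \<mu>' = sets \<mu>" "sets \<nu>' = sets \<nu>"
  shows "W2sq \<Omega> (madd \<mu> \<mu>') (madd \<nu> \<nu>') \<le> W2sq \<Omega> \<mu> \<nu> + W2sq \<Omega> \<mu>' \<nu>'"
  unfolding W2sq_def[of _ \<mu>] W2sq_def[of _ \<mu>']
proof (rule le_INF_add_INF_ennreal)
  fix \<gamma> \<gamma>' assume "\<gamma> \<in> couplings \<Omega> \<mu> \<nu>" "\<gamma>' \<in> couplings \<Omega> \<mu>' \<nu>'"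
  then have s: "sets \<gamma> = sets (LOm \<Omega> \<Otimes>\<^sub>M LOm \<Omega>)" "sets \<gamma>' = sets (LOm \<Omega> \<Otimes>\<^sub>M LOm \<Omega>)"
    and d: "distr \<gamma> (LOm \<Omega>) fst = \<mu>" "distr \<gamma> (LOm \<Omega>) snd = \<nu>"
      "distr \<gamma>' (LOm \<Omega>) fst = \<mu>'" "distr \<gamma>' (LOm \<Omega>) snd = \<nu>'"
    by (auto simp: couplings_def)
  have m: "fst \<in> measurable \<gamma> (LOm \<Omega>)" "snd \<in> measurable \<gamma> (LOm \<Omega>)"
    using s(1) measurable_cong_sets[OF s(1) refl] by (blast intro: measurable_fst measurable_snd)+
  note id = borel_measurable_LOm_ident[of \<Omega>]
  have m': "(\<lambda>z. ennreal ((fst z - snd z)^2)) \<in> borel_measurable \<gamma>"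
    using measurable_compose[OF m(1) id] measurable_compose[OF m(2) id] by measurable
  have c: "madd \<gamma> \<gamma>' \<in> couplings \<Omega> (madd \<mu> \<mu>') (madd \<nu> \<nu>')"
    using s m d by (simp add: couplings_def distr_madd)
  show "W2sq \<Omega> (madd \<mu> \<mu>') (madd \<nu> \<nu>')
      \<le> (\<integral>\<^sup>+ z. ennreal ((fst z - snd z)\<^sup>2) \<partial>\<gamma>) + (\<integral>\<^sup>+ z. ennreal ((fst z - snd z)\<^sup>2) \<partial>\<gamma>')"
    unfolding W2sq_def using s INF_lower[OF c, of "\<lambda>\<gamma>. \<integral>\<^sup>+ z. ennreal ((fst z - snd z)\<^sup>2) \<partial>\<gamma>"]
    by (simp add: nn_integral_madd[OF _ m'])
qed

text \<open>The mass described by \<open>g\<close> is placed directly at its destination, so that only \<open>f\<close> is transported.\<close>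

lemma W2sq_partial_transport_le:
  assumes T[measurable]: "T \<in> measurable (LOm \<Omega>) (LOm \<Omega>)"
    and [measurable]: "f \<in> borel_measurable (LOm \<Omega>)" "g \<in> borel_measurable (LOm \<Omega>)"
  shows "W2sq \<Omega> (madd (density (LOm \<Omega>) f) (distr (density (LOm \<Omega>) g) (LOm \<Omega>) T))
      (distr (density (LOm \<Omega>) (\<lambda>x. f x + g x)) (LOm \<Omega>) T)
    \<le> (\<integral>\<^sup>+x. f x * ennreal ((x - T x)\<^sup>2) \<partial>LOm \<Omega>)"
proof -
  let ?L = "LOm \<Omega>"
  note [measurable] = borel_measurable_LOm_ident
  define \<gamma>1 where "\<gamma>1 = distr (density ?L f) (?L \<Otimes>\<^sub>M ?L) (\<lambda>x. (x, T x))"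
  define \<gamma>2 where "\<gamma>2 = distr (density ?L g) (?L \<Otimes>\<^sub>M ?L) (\<lambda>x. (T x, T x))"
  have s: "sets \<gamma>2 = sets \<gamma>1" "sets \<gamma>1 = sets (?L \<Otimes>\<^sub>M ?L)" by (simp_all add: \<gamma>1_def \<gamma>2_def)
  have m: "fst \<in> measurable \<gamma>1 ?L" "snd \<in> measurable \<gamma>1 ?L" by (simp_all add: \<gamma>1_def)
  have Tm[measurable]: "T \<in> borel_measurable ?L"
    using measurable_compose[OF T borel_measurable_LOm_ident] .
  have fm: "fst \<in> borel_measurable (?L \<Otimes>\<^sub>M ?L)" "snd \<in> borel_measurable (?L \<Otimes>\<^sub>M ?L)"
    using measurable_compose[OF measurable_fst borel_measurable_LOm_ident]
      measurable_compose[OF measurable_snd borel_measurable_LOm_ident] by auto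
  then have m'[measurable]: "(\<lambda>z. ennreal ((fst z - snd z)^2)) \<in> borel_measurable (?L \<Otimes>\<^sub>M ?L)"
    by measurable
  have d: "distr \<gamma>1 ?L fst = density ?L f" "distr \<gamma>2 ?L fst = distr (density ?L g) ?L T"
    "distr \<gamma>1 ?L snd = distr (density ?L f) ?L T" "distr \<gamma>2 ?L snd = distr (density ?L g) ?L T"
    by (simp_all add: \<gamma>1_def \<gamma>2_def distr_distr comp_def distr_id2)
  have "madd \<gamma>1 \<gamma>2 \<in> couplings \<Omega> (madd (density ?L f) (distr (density ?L g) ?L T))
     (madd (distr (density ?L f) ?L T) (distr (density ?L g) ?L T))"
    using s m d by (simp add: couplings_def distr_madd)
  also have "madd (distr (density ?L f) ?L T) (distr (density ?L g) ?L T) = distr (density ?L (\<lambda>x. f x + g x)) ?L T"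
    by (simp add: madd_density flip: distr_madd)
  finally have "W2sq \<Omega> (madd (density ?L f) (distr (density ?L g) ?L T)) (distr (density ?L (\<lambda>x. f x + g x)) ?L T)
    \<le> (\<integral>\<^sup>+ z. ennreal ((fst z - snd z)\<^sup>2) \<partial>madd \<gamma>1 \<gamma>2)"
    unfolding W2sq_def by (rule INF_lower)
  also have "\<dots> = (\<integral>\<^sup>+ z. ennreal ((fst z - snd z)\<^sup>2) \<partial>\<gamma>1) + (\<integral>\<^sup>+ z. ennreal ((fst z - snd z)\<^sup>2) \<partial>\<gamma>2)"
    by (rule nn_integral_madd) (simp_all add: s \<gamma>1_def)
  also have "\<dots> = (\<integral>\<^sup>+x. f x * ennreal ((x - T x)\<^sup>2) \<partial>?L)"
    unfolding \<gamma>1_def \<gamma>2_def by (simp add: nn_integral_distr nn_integral_density)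
  finally show ?thesis .
qed

lemma space_LOm [simp]: "space (LOm \<Omega>) = \<Omega>"
  by (simp add: LOm_def space_restrict_space)

lemma nn_integral_LOm:
  "\<Omega> \<in> sets borel \<Longrightarrow> (\<integral>\<^sup>+x. f x \<partial>LOm \<Omega>) = (\<integral>\<^sup>+x\<in>\<Omega>. f x \<partial>lborel)"
  by (simp add: LOm_def nn_integral_restrict_space)

lemma sigma_finite_LOm: "\<Omega> \<in> sets borel \<Longrightarrow> sigma_finite_measure (LOm \<Omega>)"
  unfolding LOm_def by (rule sigma_finite_measure_restrict_space) (auto simp: lborel.sigma_finite_measure_axioms)

lemma dens_cong: "(\<And>x. x \<in> \<Omega> \<Longrightarrow> f x = g x) \<Longrightarrow> dens \<Omega> f = dens \<Omega> g"
  unfolding dens_def density_def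
  by (intro arg_cong[where f="measure_of _ _"] ext nn_integral_cong) simp

lemma energy_dens:
  assumes \<Omega>: "\<Omega> \<in> sets borel"
    and [measurable]: "f \<in> borel_measurable (LOm \<Omega>)" "g \<in> borel_measurable (LOm \<Omega>)"
    and nn: "\<And>x. x \<in> \<Omega> \<Longrightarrow> 0 \<le> f x" "\<And>x. x \<in> \<Omega> \<Longrightarrow> 0 \<le> g x"
  shows "energy \<Omega> chi (dens \<Omega> f) (dens \<Omega> g) = ereal (chi 0 * measure lborel \<Omega>) +
    enn2ereal (\<integral>\<^sup>+x. ennreal (chi (f x + g x) - chi 0) \<partial>LOm \<Omega>)"
proof -
  interpret sigma_finite_measure "LOm \<Omega>" using \<Omega> by (rule sigma_finite_LOm)
  have "AE x in LOm \<Omega>. ennreal (f x) = RN_deriv (LOm \<Omega>) (dens \<Omega> f) x"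
    "AE x in LOm \<Omega>. ennreal (g x) = RN_deriv (LOm \<Omega>) (dens \<Omega> g) x"
    by (auto intro!: RN_deriv_unique simp: dens_def)
  then have "(\<integral>\<^sup>+x. ennreal (chi (enn2real (RN_deriv (LOm \<Omega>) (dens \<Omega> f) x) + enn2real (RN_deriv (LOm \<Omega>) (dens \<Omega> g) x)) - chi 0) \<partial>LOm \<Omega>)
    = (\<integral>\<^sup>+x. ennreal (chi (f x + g x) - chi 0) \<partial>LOm \<Omega>)"
    using AE_space[of "LOm \<Omega>"]
  proof (intro nn_integral_cong_AE, eventually_elim)
    case (elim x)
    then have "enn2real (RN_deriv (LOm \<Omega>) (dens \<Omega> f) x) = f x" "enn2real (RN_deriv (LOm \<Omega>) (dens \<Omega> g) x) = g x"
      using nn[of x] by (metis enn2real_ennreal space_LOm)+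
    then show ?case by simp
  qed
  moreover have "absolutely_continuous (LOm \<Omega>) (dens \<Omega> f)" "absolutely_continuous (LOm \<Omega>) (dens \<Omega> g)"
    unfolding dens_def by (auto intro!: absolutely_continuousI_density)
  ultimately show ?thesis
    unfolding energy_def using \<Omega> by (simp add: nn_integral_LOm)
qed

lemma density_of_partial_pushforward:
  fixes s v sh :: "real \<Rightarrow> real"
  assumes \<Omega>: "\<Omega> \<in> sets borel"
    and T[measurable]: "T \<in> measurable (LOm \<Omega>) (LOm \<Omega>)"
    and [measurable]: "s \<in> borel_measurable (LOm \<Omega>)" "sh \<in> borel_measurable (LOm \<Omega>)" "v \<in> borel_measurable (LOm \<Omega>)"
    and nn: "\<And>x. x \<in> \<Omega> \<Longrightarrow> 0 \<le> v x" "\<And>x. x \<in> \<Omega> \<Longrightarrow> v x \<le> s x" "\<And>x. x \<in> \<Omega> \<Longrightarrow> 0 \<le> sh x"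
    and push: "distr (dens \<Omega> s) (LOm \<Omega>) T = dens \<Omega> sh"
  obtains u :: "real \<Rightarrow> real" where "u \<in> borel_measurable (LOm \<Omega>)" "\<And>x. 0 \<le> u x"
    "AE x in LOm \<Omega>. u x \<le> sh x" "distr (dens \<Omega> v) (LOm \<Omega>) T = dens \<Omega> u"
proof -
  let ?L = "LOm \<Omega>"
  interpret sigma_finite_measure ?L using \<Omega> by (rule sigma_finite_LOm)
  define v' where "v' x = s x - v x" for x
  have [measurable]: "v' \<in> borel_measurable ?L" unfolding v'_def by measurable
  have "madd (dens \<Omega> v) (dens \<Omega> v') = dens \<Omega> s"
    unfolding dens_def using nn
    by (subst madd_density) (auto intro!: density_cong simp: v'_def simp flip: ennreal_plus)
  moreover have "sets (dens \<Omega> v') = sets (dens \<Omega> v)" "T \<in> measurable (dens \<Omega> v) ?L"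
    by (simp_all add: dens_def)
  ultimately have sum: "madd (distr (dens \<Omega> v) ?L T) (distr (dens \<Omega> v') ?L T) = dens \<Omega> sh"
    by (simp add: push flip: distr_madd)
  have le: "emeasure (distr (dens \<Omega> v) ?L T) A \<le> emeasure (dens \<Omega> sh) A"
    "emeasure (distr (dens \<Omega> v') ?L T) A \<le> emeasure (dens \<Omega> sh) A" for A
    unfolding sum[symmetric] by (simp_all add: emeasure_madd)
  have nul: "A \<in> null_sets (dens \<Omega> sh)" if "A \<in> null_sets ?L" for A
    using absolutely_continuousI_density[of "\<lambda>x. ennreal (sh x)" ?L] that
    by (auto simp: absolutely_continuous_def dens_def)
  have ac: "absolutely_continuous ?L (distr (dens \<Omega> v) ?L T)" "absolutely_continuous ?L (distr (dens \<Omega> v') ?L T)"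
    unfolding absolutely_continuous_def
  proof safe
    fix A assume A: "A \<in> null_sets ?L"
    then have "emeasure (dens \<Omega> sh) A = 0" "A \<in> sets ?L" using nul by auto
    then show "A \<in> null_sets (distr (dens \<Omega> v) ?L T)" "A \<in> null_sets (distr (dens \<Omega> v') ?L T)"
      using le[of A] by (auto intro!: null_setsI)
  qed
  obtain u0 where u0[measurable]: "u0 \<in> borel_measurable ?L" and u0d: "density ?L u0 = distr (dens \<Omega> v) ?L T"
    using Radon_Nikodym[OF ac(1)] by auto
  obtain u1 where u1[measurable]: "u1 \<in> borel_measurable ?L" and u1d: "density ?L u1 = distr (dens \<Omega> v') ?L T"
    using Radon_Nikodym[OF ac(2)] by auto
  have "density ?L (\<lambda>x. u0 x + u1 x) = density ?L (\<lambda>x. ennreal (sh x))"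
    using sum unfolding dens_def[of _ sh] u0d[symmetric] u1d[symmetric] by (simp add: madd_density)
  then have "AE x in ?L. u0 x + u1 x = ennreal (sh x)"
    by (rule density_unique[rotated -1]) auto
  then have ae: "AE x in ?L. u0 x \<le> ennreal (sh x)"
    by eventually_elim (metis le_iff_add)
  then have ae': "AE x in ?L. ennreal (enn2real (u0 x)) = u0 x"
    by eventually_elim (metis ennreal_enn2real_if ennreal_neq_top top_unique)
  show ?thesis
  proof (rule that)
    show "(\<lambda>x. enn2real (u0 x)) \<in> borel_measurable ?L" by measurable
    show "AE x in ?L. enn2real (u0 x) \<le> sh x"
      using ae AE_space
    proof eventually_elim
      case (elim x)
      then show ?case using nn(3)[of x] enn2real_mono[of "u0 x" "ennreal (sh x)"] by simp
    qed
    show "distr (dens \<Omega> v) ?L T = dens \<Omega> (\<lambda>x. enn2real (u0 x))"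
      unfolding dens_def[of _ "\<lambda>x. enn2real (u0 x)"] u0d[symmetric] using ae' by (intro density_cong) auto
  qed simp
qed

lemma partial_transport_competitor:
  fixes s sh v u w :: "real \<Rightarrow> real"
  assumes T[measurable]: "T \<in> measurable (LOm \<Omega>) (LOm \<Omega>)"
    and [measurable]: "s \<in> borel_measurable (LOm \<Omega>)" "sh \<in> borel_measurable (LOm \<Omega>)"
      "v \<in> borel_measurable (LOm \<Omega>)" "u \<in> borel_measurable (LOm \<Omega>)" "w \<in> borel_measurable (LOm \<Omega>)"
    and nn: "\<And>x. x \<in> \<Omega> \<Longrightarrow> 0 \<le> v x" "\<And>x. x \<in> \<Omega> \<Longrightarrow> v x \<le> s x" "\<And>x. x \<in> \<Omega> \<Longrightarrow> 0 \<le> sh x"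
      "\<And>x. x \<in> \<Omega> \<Longrightarrow> 0 \<le> u x" "\<And>x. x \<in> \<Omega> \<Longrightarrow> 0 \<le> w x"
    and push: "distr (dens \<Omega> s) (LOm \<Omega>) T = dens \<Omega> sh" "distr (dens \<Omega> v) (LOm \<Omega>) T = dens \<Omega> u"
  defines "h \<equiv> \<lambda>x. w (T x) * (s x - v x) + w x * u x"
  shows "W2sq \<Omega> (dens \<Omega> h) (dens \<Omega> (\<lambda>x. w x * sh x)) \<le> (\<integral>\<^sup>+x. ennreal (w (T x) * (s x - v x) * (x - T x)\<^sup>2) \<partial>LOm \<Omega>)"
    and "dens \<Omega> h \<in> meas_on \<Omega> (\<integral>\<^sup>+x. ennreal (w x * sh x) \<partial>LOm \<Omega>)"
proof -
  let ?L = "LOm \<Omega>"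
  have T\<Omega>: "T x \<in> \<Omega>" if "x \<in> \<Omega>" for x using measurable_space[OF T] that by simp
  define f where "f x = ennreal (w (T x) * (s x - v x))" for x
  define g where "g x = ennreal (w (T x) * v x)" for x
  have [measurable]: "f \<in> borel_measurable ?L" "g \<in> borel_measurable ?L" unfolding f_def g_def by measurable
  have pushw: "distr (density ?L (\<lambda>x. ennreal (w (T x) * z x))) ?L T = dens \<Omega> (\<lambda>x. w x * y x)"
    if z: "distr (dens \<Omega> z) ?L T = dens \<Omega> y" and [measurable]: "z \<in> borel_measurable ?L" "y \<in> borel_measurable ?L"
      and pos: "\<And>x. x \<in> \<Omega> \<Longrightarrow> 0 \<le> z x" "\<And>x. x \<in> \<Omega> \<Longrightarrow> 0 \<le> y x" for z y
  proof -
    have "density ?L (\<lambda>x. ennreal (w (T x) * z x)) = density (dens \<Omega> z) (\<lambda>x. ennreal (w (T x)))"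
      unfolding dens_def using pos nn(5) T\<Omega>
      by (subst density_density_eq) (auto intro!: density_cong simp: ennreal_mult mult.commute)
    then have "distr (density ?L (\<lambda>x. ennreal (w (T x) * z x))) ?L T = density (distr (dens \<Omega> z) ?L T) (\<lambda>x. ennreal (w x))"
      by (subst density_distr) (auto simp: dens_def)
    also have "\<dots> = dens \<Omega> (\<lambda>x. w x * y x)"
      unfolding z unfolding dens_def using pos nn(5)
      by (subst density_density_eq) (auto intro!: density_cong simp: ennreal_mult mult.commute)
    finally show ?thesis .
  qed
  have fg: "density ?L (\<lambda>x. f x + g x) = density ?L (\<lambda>x. ennreal (w (T x) * s x))"
  proof (intro density_cong AE_I2)
    fix x assume "x \<in> space ?L"
    then have "0 \<le> w (T x) * (s x - v x)" "0 \<le> w (T x) * v x" using nn T\<Omega> by auto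
    then show "f x + g x = ennreal (w (T x) * s x)"
      by (simp add: f_def g_def algebra_simps flip: ennreal_plus)
  qed auto
  have s0: "x \<in> \<Omega> \<Longrightarrow> 0 \<le> s x" for x using nn(1,2)[of x] by simp
  have dfg: "distr (density ?L (\<lambda>x. f x + g x)) ?L T = dens \<Omega> (\<lambda>x. w x * sh x)"
    unfolding fg by (rule pushw[OF push(1)]) (auto simp: nn s0)
  have dg: "distr (density ?L g) ?L T = dens \<Omega> (\<lambda>x. w x * u x)"
    unfolding g_def by (rule pushw[OF push(2)]) (auto simp: nn)
  have h: "madd (density ?L f) (distr (density ?L g) ?L T) = dens \<Omega> h"
    unfolding dg dens_def f_def h_def using nn T\<Omega>
    by (subst madd_density) (auto intro!: density_cong simp flip: ennreal_plus)
  have "W2sq \<Omega> (dens \<Omega> h) (dens \<Omega> (\<lambda>x. w x * sh x)) \<le> (\<integral>\<^sup>+x. f x * ennreal ((x - T x)\<^sup>2) \<partial>?L)"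
    using W2sq_partial_transport_le[OF T, of f g] by (simp add: h dfg)
  also have "\<dots> = (\<integral>\<^sup>+x. ennreal (w (T x) * (s x - v x) * (x - T x)\<^sup>2) \<partial>LOm \<Omega>)"
    by (auto intro!: nn_integral_cong simp: f_def nn T\<Omega> ennreal_mult'')
  finally show "W2sq \<Omega> (dens \<Omega> h) (dens \<Omega> (\<lambda>x. w x * sh x)) \<le> (\<integral>\<^sup>+x. ennreal (w (T x) * (s x - v x) * (x - T x)\<^sup>2) \<partial>LOm \<Omega>)" .
  have \<Omega>L: "\<Omega> \<in> sets ?L" using sets.top[of ?L] by simp
  have V: "T -` \<Omega> \<inter> \<Omega> = \<Omega>" using T\<Omega> by auto
  have "emeasure (dens \<Omega> h) \<Omega> = emeasure (distr (density ?L (\<lambda>x. f x + g x)) ?L T) \<Omega>"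
    unfolding h[symmetric] using \<Omega>L V
    by (simp add: emeasure_madd emeasure_distr flip: madd_density)
  also have "\<dots> = (\<integral>\<^sup>+x. ennreal (w x * sh x) \<partial>LOm \<Omega>)"
    unfolding dfg dens_def using \<Omega>L
    by (auto simp: emeasure_density intro!: nn_integral_cong)
  finally show "dens \<Omega> h \<in> meas_on \<Omega> (\<integral>\<^sup>+x. ennreal (w x * sh x) \<partial>LOm \<Omega>)"
    by (simp add: meas_on_def dens_def)
qed

lemma W2sq_dens_self:
  assumes [measurable]: "f \<in> borel_measurable (LOm \<Omega>)"
  shows "W2sq \<Omega> (dens \<Omega> f) (dens \<Omega> f) = 0"
  using W2sq_partial_transport_le[of "\<lambda>x. x" \<Omega> "\<lambda>x. 0" "\<lambda>x. ennreal (f x)"]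
  by (simp add: distr_id2 madd_density dens_def)

section \<open>The maximum principle for the diffusion step\<close>

locale energy_density =
  fixes chi dchi ddchi :: "real \<Rightarrow> real"
  assumes chi_cont: "continuous_on {0..} chi"
    and chi_d1: "\<And>x. x > 0 \<Longrightarrow> (chi has_real_derivative dchi x) (at x)"
    and chi_d2: "\<And>x. x > 0 \<Longrightarrow> (dchi has_real_derivative ddchi x) (at x)"
    and chi_conv: "\<And>x. x > 0 \<Longrightarrow> ddchi x > 0"
    and chi_lim: "(dchi \<longlongrightarrow> 0) (at_right 0)"
begin

lemma dchi_mono: "0 < x \<Longrightarrow> x \<le> y \<Longrightarrow> dchi x \<le> dchi y"
  using chi_d2 chi_conv
  by (intro DERIV_nonneg_imp_nondecreasing[of x y dchi]) (meson less_imp_le order_less_le_trans)+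

lemma dchi_nonneg:
  assumes "0 < x"
  shows "0 \<le> dchi x"
proof (rule tendsto_upperbound[OF chi_lim])
  show "\<forall>\<^sub>F y in at_right 0. dchi y \<le> dchi x"
    using assms by (auto simp: eventually_at_right_field intro!: exI[of _ x] dchi_mono)
qed simp

lemma chi_secant:
  assumes "0 \<le> x" "x < y"
  obtains z where "x < z" "z < y" "chi y - chi x = (y - x) * dchi z"
proof -
  have "continuous_on {x..y} chi"
    using chi_cont by (rule continuous_on_subset) (use assms in auto)
  moreover have "(chi has_derivative (\<lambda>h. h * dchi z)) (at z)" if "x < z" "z < y" for z
    using chi_d1[of z] that assms by (simp add: has_field_derivative_def mult.commute[of _ "dchi z"])
  ultimately obtain z where "x < z" "z < y" "chi y - chi x = (y - x) * dchi z"
    using mvt[OF assms(2), of chi "\<lambda>z h. h * dchi z"] by auto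
  then show ?thesis by (rule that)
qed

lemma chi_diff_le: "0 \<le> x \<Longrightarrow> x \<le> y \<Longrightarrow> y \<le> z \<Longrightarrow> 0 < z \<Longrightarrow> chi y - chi x \<le> (y - x) * dchi z"
proof (cases "x = y")
  case False
  assume "0 \<le> x" "x \<le> y" "y \<le> z" "0 < z"
  moreover from this False obtain c where "x < c" "c < y" "chi y - chi x = (y - x) * dchi c"
    using chi_secant[of x y] by auto
  ultimately show ?thesis by (auto intro!: mult_left_mono dchi_mono)
qed simp

lemma chi_diff_ge: "0 < w \<Longrightarrow> w \<le> x \<Longrightarrow> x \<le> y \<Longrightarrow> (y - x) * dchi w \<le> chi y - chi x"
proof (cases "x = y")
  case False
  assume "0 < w" "w \<le> x" "x \<le> y"
  moreover from this False obtain c where "x < c" "c < y" "chi y - chi x = (y - x) * dchi c"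
    using chi_secant[of x y] by auto
  ultimately show ?thesis by (auto intro!: mult_left_mono dchi_mono)
qed simp

lemma chi_mono:
  assumes "0 \<le> x" "x \<le> y"
  shows "chi x \<le> chi y"
proof (cases "x = y")
  case False
  then obtain z where z: "x < z" "z < y" "chi y - chi x = (y - x) * dchi z"
    using chi_secant[of x y] assms by auto
  then have "0 \<le> (y - x) * dchi z" using assms by (intro mult_nonneg_nonneg dchi_nonneg) auto
  then show ?thesis using z by simp
qed simp

lemma chi_borel_measurable:
  assumes "f \<in> borel_measurable N" "\<And>x. x \<in> space N \<Longrightarrow> 0 \<le> f x"
  shows "(\<lambda>x. chi (f x)) \<in> borel_measurable N"
proof (rule measurable_compose[of f N "restrict_space borel {0..}"])
  show "f \<in> measurable N (restrict_space borel {0..})"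
    using assms by (intro measurable_restrict_space2) auto
  show "chi \<in> borel_measurable (restrict_space borel {0..})"
    using chi_cont by (rule borel_measurable_continuous_on_restrict)
qed

lemma chi_competitor_le:
  assumes "0 < M" "0 < e" "e < 1" "0 \<le> s" "0 \<le> u" "u \<le> M"
    and v: "v = 0 \<or> (v = s \<and> M < s)" and u: "M < s \<longrightarrow> u = 0"
  shows "chi (s - e * v + e * u) + e * dchi ((1 - e) * M) * v \<le> chi s + e * dchi ((1 + e) * M) * u"
proof (cases "M < s")
  case True
  then have "u = 0" using u by simp
  moreover have "(s - (1 - e) * s) * dchi ((1 - e) * M) \<le> chi s - chi ((1 - e) * s)"
    using assms True by (intro chi_diff_ge mult_left_mono mult_pos_pos) (auto simp: mult_le_cancel_right1)
  ultimately show ?thesis using v by (auto simp: algebra_simps)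
next
  case False
  then have "v = 0" using v by auto
  moreover have "chi (s + e * u) - chi s \<le> ((s + e * u) - s) * dchi ((1 + e) * M)"
    using assms False by (intro chi_diff_le) (auto simp: algebra_simps intro!: add_mono mult_left_mono mult_pos_pos add_pos_pos)
  ultimately show ?thesis by (auto simp: algebra_simps)
qed

lemma jko_max_principle:
  fixes M \<tau> :: real
  assumes \<Omega>: "\<Omega> \<in> sets borel" "emeasure lborel \<Omega> < \<infinity>"
    and \<tau>: "0 < \<tau>" and M: "0 < M"
    and [measurable]: "rho \<in> borel_measurable (LOm \<Omega>)" "eta \<in> borel_measurable (LOm \<Omega>)"
      "sh \<in> borel_measurable (LOm \<Omega>)" "rh \<in> borel_measurable (LOm \<Omega>)"
    and nn: "\<And>x. x \<in> \<Omega> \<Longrightarrow> 0 \<le> rho x" "\<And>x. x \<in> \<Omega> \<Longrightarrow> 0 \<le> eta x"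
      "\<And>x. x \<in> \<Omega> \<Longrightarrow> 0 \<le> sh x" "\<And>x. x \<in> \<Omega> \<Longrightarrow> 0 \<le> rh x" "\<And>x. x \<in> \<Omega> \<Longrightarrow> rh x \<le> 1"
    and bnd: "AE x in LOm \<Omega>. sh x \<le> M"
    and min: "\<And>\<mu> \<nu>. \<mu> \<in> meas_on \<Omega> (\<integral>\<^sup>+x. ennreal (rh x * sh x) \<partial>LOm \<Omega>) \<Longrightarrow>
        \<nu> \<in> meas_on \<Omega> (\<integral>\<^sup>+x. ennreal ((1 - rh x) * sh x) \<partial>LOm \<Omega>) \<Longrightarrow>
        jko \<Omega> chi \<tau> (dens \<Omega> (\<lambda>x. rh x * sh x)) (dens \<Omega> (\<lambda>x. (1 - rh x) * sh x)) (dens \<Omega> rho) (dens \<Omega> eta)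
        \<le> jko \<Omega> chi \<tau> (dens \<Omega> (\<lambda>x. rh x * sh x)) (dens \<Omega> (\<lambda>x. (1 - rh x) * sh x)) \<mu> \<nu>"
    and T[measurable]: "T \<in> measurable (LOm \<Omega>) (LOm \<Omega>)"
    and push: "distr (dens \<Omega> (\<lambda>x. rho x + eta x)) (LOm \<Omega>) T = dens \<Omega> sh"
    and opt: "(\<integral>\<^sup>+x. ennreal ((x - T x)\<^sup>2) \<partial>dens \<Omega> (\<lambda>x. rho x + eta x))
        = W2sq \<Omega> (dens \<Omega> (\<lambda>x. rho x + eta x)) (dens \<Omega> sh)"
  shows "AE x in LOm \<Omega>. rho x + eta x \<le> M"
proof -
  let ?L = "LOm \<Omega>"
  let ?ph = "\<lambda>x. rh x * sh x" and ?eh = "\<lambda>x. (1 - rh x) * sh x"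
  define s where "s x = rho x + eta x" for x
  define B where "B = {x\<in>\<Omega>. M < s x \<and> s (T x) \<le> M}"
  define v where "v x = s x * indicator B x" for x
  define C where "C = (\<integral>\<^sup>+x. ennreal (s x * (x - T x)\<^sup>2) \<partial>?L)"
  define D where "D = (\<integral>\<^sup>+x. ennreal (v x * (x - T x)\<^sup>2) \<partial>?L)"
  define I where "I = (\<integral>\<^sup>+x. ennreal (chi (s x) - chi 0) \<partial>?L)"
  define W where "W = W2sq \<Omega> (dens \<Omega> rho) (dens \<Omega> ?ph) + W2sq \<Omega> (dens \<Omega> eta) (dens \<Omega> ?eh)"
  define k where "k = chi 0 * measure lborel \<Omega>"
  note [measurable] = borel_measurable_LOm_ident
  have [measurable]: "T \<in> borel_measurable ?L"
    using measurable_compose[OF T borel_measurable_LOm_ident] .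
  have T\<Omega>: "T x \<in> \<Omega>" if "x \<in> \<Omega>" for x using measurable_space[OF T] that by simp
  have \<Omega>L: "\<Omega> \<in> sets ?L" using sets.top[of ?L] by simp
  have L\<Omega>: "emeasure ?L \<Omega> < \<infinity>" using \<Omega> by (simp add: LOm_def emeasure_restrict_space)
  have s_meas[measurable]: "s \<in> borel_measurable ?L" unfolding s_def by measurable
  have B_meas[measurable]: "B \<in> sets ?L"
  proof -
    have "B = {x\<in>space ?L. M < s x \<and> s (T x) \<le> M}" by (simp add: B_def)
    also have "\<dots> \<in> sets ?L" by measurable
    finally show ?thesis .
  qed
  have v_meas[measurable]: "v \<in> borel_measurable ?L" unfolding v_def by measurable
  have s0: "0 \<le> s x" if "x \<in> \<Omega>" for x using nn that by (simp add: s_def)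
  have v0: "0 \<le> v x" "v x \<le> s x" if "x \<in> \<Omega>" for x
    using s0[OF that] by (auto simp: v_def indicator_def)
  have push': "distr (dens \<Omega> s) ?L T = dens \<Omega> sh" using push by (simp add: s_def[abs_def])

  have chi_int: "chi_int \<in> borel_measurable ?L" if "chi_int = (\<lambda>x. ennreal (chi (f x) - chi 0))"
    "f \<in> borel_measurable ?L" "\<And>x. x \<in> \<Omega> \<Longrightarrow> 0 \<le> f x" for f chi_int
  proof -
    have [measurable]: "(\<lambda>x. chi (f x)) \<in> borel_measurable ?L"
      by (rule chi_borel_measurable) (use that in auto)
    show ?thesis unfolding that(1) by measurable
  qed

  have dens_s: "dens \<Omega> s = madd (dens \<Omega> rho) (dens \<Omega> eta)"
    unfolding dens_def s_def using nn by (subst madd_density) (auto intro!: density_cong)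
  have dens_sh: "dens \<Omega> sh = madd (dens \<Omega> ?ph) (dens \<Omega> ?eh)"
    unfolding dens_def
  proof (subst madd_density, simp_all, intro density_cong AE_I2)
    fix x assume "x \<in> space ?L"
    then have "0 \<le> ?ph x" "0 \<le> ?eh x" using nn by auto
    then show "ennreal (sh x) = ennreal (?ph x) + ennreal (?eh x)"
      by (simp add: algebra_simps flip: ennreal_plus)
  qed auto
  have "C = (\<integral>\<^sup>+x. ennreal ((x - T x)\<^sup>2) \<partial>dens \<Omega> s)"
    unfolding C_def dens_def using s0
    by (subst nn_integral_density) (auto intro!: nn_integral_cong simp: ennreal_mult)
  also have "\<dots> = W2sq \<Omega> (dens \<Omega> s) (dens \<Omega> sh)" using opt by (simp add: s_def[abs_def])
  also have "\<dots> \<le> W"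
    unfolding dens_s dens_sh W_def by (rule W2sq_madd_le) (simp_all add: dens_def)
  finally have CW: "C \<le> W" .

  have jko_min: "jko \<Omega> chi \<tau> (dens \<Omega> ?ph) (dens \<Omega> ?eh) (dens \<Omega> rho) (dens \<Omega> eta)
      = ereal (1 / (2 * \<tau>)) * enn2ereal W + (ereal k + enn2ereal I)"
    unfolding jko_def W_def I_def k_def s_def using \<Omega> nn by (simp add: energy_dens)

  define Ih where "Ih = (\<integral>\<^sup>+x. ennreal (chi (sh x) - chi 0) \<partial>?L)"
  have "Ih \<le> (\<integral>\<^sup>+x. ennreal (chi M - chi 0) \<partial>?L)"
    unfolding Ih_def
  proof (rule nn_integral_mono_AE)
    show "AE x in ?L. ennreal (chi (sh x) - chi 0) \<le> ennreal (chi M - chi 0)"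
      using bnd AE_space
    proof eventually_elim
      case (elim x)
      then show ?case using chi_mono[of "sh x" M] nn(3)[of x] by (intro ennreal_leI) auto
    qed
  qed
  also have "\<dots> < \<infinity>" using L\<Omega> by (simp add: ennreal_mult_less_top)
  finally have Ih: "Ih < \<infinity>" .
  have meas_h: "dens \<Omega> ?ph \<in> meas_on \<Omega> (\<integral>\<^sup>+x. ennreal (?ph x) \<partial>?L)"
    "dens \<Omega> ?eh \<in> meas_on \<Omega> (\<integral>\<^sup>+x. ennreal (?eh x) \<partial>?L)"
    unfolding meas_on_def dens_def using \<Omega>L by (auto simp: emeasure_density intro!: nn_integral_cong)
  have "energy \<Omega> chi (dens \<Omega> ?ph) (dens \<Omega> ?eh) = ereal k + enn2ereal (\<integral>\<^sup>+x. ennreal (chi (?ph x + ?eh x) - chi 0) \<partial>?L)"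
    unfolding k_def using \<Omega> nn by (intro energy_dens) auto
  also have "(\<lambda>x. ?ph x + ?eh x) = sh" by (auto simp: algebra_simps)
  then have "(\<integral>\<^sup>+x. ennreal (chi (?ph x + ?eh x) - chi 0) \<partial>?L) = Ih"
    unfolding Ih_def by (metis (no_types))
  finally have "jko \<Omega> chi \<tau> (dens \<Omega> ?ph) (dens \<Omega> ?eh) (dens \<Omega> ?ph) (dens \<Omega> ?eh) = ereal k + enn2ereal Ih"
    unfolding jko_def by (simp add: W2sq_dens_self zero_ennreal.rep_eq)
  with min[OF meas_h] have fin: "ereal (1 / (2 * \<tau>)) * enn2ereal W + (ereal k + enn2ereal I) \<le> ereal k + enn2ereal Ih"
    unfolding jko_min by simp
  obtain ih where ih: "0 \<le> ih" "Ih = ennreal ih" using Ih by (cases Ih) auto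
  have "W < \<infinity>" "I < \<infinity>"
    using fin \<tau> unfolding ih by (cases W; cases I; simp)+
  then obtain w i where w: "0 \<le> w" "W = ennreal w" and i: "0 \<le> i" "I = ennreal i"
    by (cases W; cases I) auto
  obtain c where c: "0 \<le> c" "C = ennreal c" "c \<le> w" using CW w by (cases C) (auto simp: top_unique)
  have DC: "D \<le> C"
    unfolding D_def C_def using v0
    by (auto intro!: nn_integral_mono ennreal_leI mult_right_mono)
  then obtain d where d: "0 \<le> d" "D = ennreal d" using c by (cases D) (auto simp: top_unique)

  have mass_s: "(\<integral>\<^sup>+x. ennreal (s x) * indicator A (T x) \<partial>?L) = (\<integral>\<^sup>+x. ennreal (sh x) * indicator A x \<partial>?L)"
    if [measurable]: "A \<in> sets ?L" for A
  proof -
    have "(\<integral>\<^sup>+x. ennreal (s x) * indicator A (T x) \<partial>?L) = (\<integral>\<^sup>+x. indicator A x \<partial>distr (dens \<Omega> s) ?L T)"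
      by (subst nn_integral_distr) (auto simp: dens_def nn_integral_density)
    also have "\<dots> = (\<integral>\<^sup>+x. ennreal (sh x) * indicator A x \<partial>?L)"
      unfolding push' by (simp add: dens_def emeasure_density)
    finally show ?thesis .
  qed
  have sh_le: "(\<integral>\<^sup>+x. ennreal (sh x) * indicator A x \<partial>?L) \<le> ennreal M * emeasure ?L A"
    if [measurable]: "A \<in> sets ?L" for A
  proof -
    have "(\<integral>\<^sup>+x. ennreal (sh x) * indicator A x \<partial>?L) \<le> (\<integral>\<^sup>+x. ennreal M * indicator A x \<partial>?L)"
      using bnd by (intro nn_integral_mono_AE) (auto elim!: eventually_mono intro!: mult_right_mono ennreal_leI)
    also have "\<dots> = ennreal M * emeasure ?L A" by (simp add: nn_integral_cmult)
    finally show ?thesis .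
  qed

  show ?thesis
  proof (cases "d = 0")
    case True
    define A where "A = {x\<in>space ?L. M < s x}"
    have [measurable]: "A \<in> sets ?L" unfolding A_def by measurable
    have "AE x in ?L. ennreal (v x * (x - T x)\<^sup>2) = 0"
      using True d unfolding D_def by (subst nn_integral_0_iff_AE[symmetric]) auto
    then have stay: "AE x in ?L. x \<in> A \<longrightarrow> T x \<in> A"
      using AE_space
    proof eventually_elim
      case (elim x)
      show ?case
      proof (rule impI, rule ccontr)
        assume x: "x \<in> A" "T x \<notin> A"
        then have "x \<in> B" "x \<noteq> T x" using T\<Omega>[of x] by (auto simp: A_def B_def)
        then have "0 < v x * (x - T x)\<^sup>2" using x M by (auto simp: v_def A_def)
        then show False using elim(1) by auto
      qed
    qed
    have A_fin: "emeasure ?L A < \<infinity>"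
      using emeasure_mono[of A \<Omega> ?L] \<Omega>L L\<Omega> by (auto simp: A_def)
    have "(\<integral>\<^sup>+x. ennreal (s x - M) * indicator A x \<partial>?L) + ennreal M * emeasure ?L A
        = (\<integral>\<^sup>+x. ennreal (s x - M) * indicator A x + ennreal M * indicator A x \<partial>?L)"
      by (simp add: nn_integral_add nn_integral_cmult)
    also have "\<dots> = (\<integral>\<^sup>+x. ennreal (s x) * indicator A x \<partial>?L)"
      using M by (intro nn_integral_cong) (auto simp: A_def indicator_def simp flip: ennreal_plus)
    also have "\<dots> \<le> (\<integral>\<^sup>+x. ennreal (s x) * indicator A (T x) \<partial>?L)"
      using stay by (intro nn_integral_mono_AE) (auto elim!: eventually_mono simp: indicator_def)
    also have "\<dots> \<le> ennreal M * emeasure ?L A" using sh_le mass_s by simp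
    finally have "(\<integral>\<^sup>+x. ennreal (s x - M) * indicator A x \<partial>?L) + ennreal M * emeasure ?L A \<le> ennreal M * emeasure ?L A" .
    then have "(\<integral>\<^sup>+x. ennreal (s x - M) * indicator A x \<partial>?L) = 0"
      using A_fin by (cases "emeasure ?L A"; cases "\<integral>\<^sup>+x. ennreal (s x - M) * indicator A x \<partial>?L")
        (use M in \<open>auto simp: top_unique ennreal_mult[symmetric] simp flip: ennreal_plus\<close>)
    then have "AE x in ?L. ennreal (s x - M) * indicator A x = 0"
      by (subst nn_integral_0_iff_AE[symmetric]) auto
    then show ?thesis
      using AE_space
    proof eventually_elim
      case (elim x)
      then show ?case by (auto simp: A_def s_def indicator_def ennreal_eq_0_iff split: if_splits)
    qed
  next
    case False
    \<comment> \<open>\<open>u\<close> is where \<open>v\<close> came from: it lives on \<open>s \<le> M\<close>, so the competitor density \<open>s - e v + e u\<close> is flatter than \<open>s\<close>.\<close>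
    obtain u :: "real \<Rightarrow> real" where u[measurable]: "u \<in> borel_measurable ?L" and u0: "\<And>x. 0 \<le> u x"
      and ush: "AE x in ?L. u x \<le> sh x" and pushv: "distr (dens \<Omega> v) ?L T = dens \<Omega> u"
      using density_of_partial_pushforward[OF \<Omega>(1) T s_meas _ v_meas v0 nn(3) push'] by auto
    have uM: "AE x in ?L. u x \<le> M" using ush bnd by eventually_elim simp
    have push_uv: "(\<integral>\<^sup>+x. f x \<partial>dens \<Omega> u) = (\<integral>\<^sup>+x. ennreal (v x) * f (T x) \<partial>?L)"
      if [measurable]: "f \<in> borel_measurable ?L" for f
      unfolding pushv[symmetric] by (simp add: nn_integral_distr dens_def nn_integral_density)
    have uA: "AE x in ?L. M < s x \<longrightarrow> u x = 0"
    proof -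
      define A where "A = {x\<in>space ?L. M < s x}"
      have [measurable]: "A \<in> sets ?L" unfolding A_def by measurable
      have "(\<integral>\<^sup>+x. ennreal (u x) * indicator A x \<partial>?L) = (\<integral>\<^sup>+x. ennreal (v x) * indicator A (T x) \<partial>?L)"
        using push_uv[of "indicator A"] by (simp add: dens_def emeasure_density)
      also have "\<dots> = (\<integral>\<^sup>+x. 0 \<partial>?L)"
        by (intro nn_integral_cong) (auto simp: v_def A_def B_def indicator_def)
      finally have "(\<integral>\<^sup>+x. ennreal (u x) * indicator A x \<partial>?L) = 0" by simp
      then have "AE x in ?L. ennreal (u x) * indicator A x = 0"
        by (subst nn_integral_0_iff_AE[symmetric]) auto
      then show ?thesis
        using AE_space
      proof eventually_elim
        case (elim x)
        then show ?case using u0[of x] by (auto simp: A_def indicator_def ennreal_eq_0_iff split: if_splits)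
      qed
    qed
    define m where "m = enn2real (\<integral>\<^sup>+x. ennreal (v x) \<partial>?L)"
    have "(\<integral>\<^sup>+x. ennreal (v x) \<partial>?L) \<le> (\<integral>\<^sup>+x. ennreal (s x) * indicator \<Omega> (T x) \<partial>?L)"
      using v0 T\<Omega> by (intro nn_integral_mono) (auto intro!: ennreal_leI)
    also have "\<dots> \<le> ennreal M * emeasure ?L \<Omega>" using sh_le mass_s \<Omega>L by simp
    also have "\<dots> < \<infinity>" using L\<Omega> by (simp add: ennreal_mult_less_top)
    finally have m: "0 \<le> m" "(\<integral>\<^sup>+x. ennreal (v x) \<partial>?L) = ennreal m"
      unfolding m_def by auto
    have mu: "(\<integral>\<^sup>+x. ennreal (u x) \<partial>?L) = ennreal m"
      using push_uv[of "\<lambda>_. 1"] m(2) by (simp add: dens_def nn_integral_density del: nn_integral_const)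
    have key: "d \<le> 2 * \<tau> * m * (dchi ((1 + e) * M) - dchi ((1 - e) * M))" if e: "0 < e" "e < 1" for e
    proof -
      define P where "P w x = w (T x) * (s x - e * v x) + w x * (e * u x)" for w :: "real \<Rightarrow> real" and x
      define f where "f x = s x - e * v x + e * u x" for x
      let ?C' = "\<integral>\<^sup>+x. ennreal ((s x - e * v x) * (x - T x)\<^sup>2) \<partial>?L"
      let ?I' = "\<integral>\<^sup>+x. ennreal (chi (f x) - chi 0) \<partial>?L"
      have ev: "0 \<le> e * v x" "e * v x \<le> s x" if "x \<in> \<Omega>" for x
        using v0[OF that] e mult_left_le_one_le[of "v x" e] by auto
      have [measurable]: "P w \<in> borel_measurable ?L" if [measurable]: "w \<in> borel_measurable ?L" for w
        unfolding P_def by measurable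
      have scale: "dens \<Omega> (\<lambda>x. e * g x) = density (dens \<Omega> g) (\<lambda>_. ennreal e)"
        if [measurable]: "g \<in> borel_measurable ?L" and "\<And>x. x \<in> \<Omega> \<Longrightarrow> 0 \<le> g x" for g
        unfolding dens_def using that e
        by (subst density_density_eq) (auto intro!: density_cong simp: ennreal_mult mult.commute)
      have pushe: "distr (dens \<Omega> (\<lambda>x. e * v x)) ?L T = dens \<Omega> (\<lambda>x. e * u x)"
      proof -
        have "distr (dens \<Omega> (\<lambda>x. e * v x)) ?L T = distr (density (dens \<Omega> v) (\<lambda>_. ennreal e)) ?L T"
          by (simp add: scale v0)
        also have "\<dots> = density (distr (dens \<Omega> v) ?L T) (\<lambda>_. ennreal e)"
          by (subst density_distr) (simp_all add: dens_def)
        also have "\<dots> = dens \<Omega> (\<lambda>x. e * u x)" unfolding pushv by (simp add: scale u0)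
        finally show ?thesis .
      qed
      have comp: "W2sq \<Omega> (dens \<Omega> (P w)) (dens \<Omega> (\<lambda>x. w x * sh x)) \<le> (\<integral>\<^sup>+x. ennreal (w (T x) * (s x - e * v x) * (x - T x)\<^sup>2) \<partial>?L)"
        "dens \<Omega> (P w) \<in> meas_on \<Omega> (\<integral>\<^sup>+x. ennreal (w x * sh x) \<partial>?L)"
        if [measurable]: "w \<in> borel_measurable ?L" and w0: "\<And>x. x \<in> \<Omega> \<Longrightarrow> 0 \<le> w x" for w
        unfolding P_def
        by (rule partial_transport_competitor; use ev nn u0 e w0 push' pushe in simp)+
      define W' where "W' = W2sq \<Omega> (dens \<Omega> (P rh)) (dens \<Omega> ?ph) + W2sq \<Omega> (dens \<Omega> (P (\<lambda>x. 1 - rh x))) (dens \<Omega> ?eh)"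
      have "W' \<le> (\<integral>\<^sup>+x. ennreal (rh (T x) * (s x - e * v x) * (x - T x)\<^sup>2) \<partial>?L)
         + (\<integral>\<^sup>+x. ennreal ((1 - rh (T x)) * (s x - e * v x) * (x - T x)\<^sup>2) \<partial>?L)"
        unfolding W'_def using nn by (intro add_mono comp) auto
      also have "\<dots> = (\<integral>\<^sup>+x. ennreal (rh (T x) * (s x - e * v x) * (x - T x)\<^sup>2) + ennreal ((1 - rh (T x)) * (s x - e * v x) * (x - T x)\<^sup>2) \<partial>?L)"
        by (simp add: nn_integral_add)
      also have "\<dots> = ?C'"
      proof (rule nn_integral_cong)
        fix x assume "x \<in> space ?L"
        then have "0 \<le> rh (T x) * (s x - e * v x) * (x - T x)\<^sup>2" "0 \<le> (1 - rh (T x)) * (s x - e * v x) * (x - T x)\<^sup>2"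
          using ev nn T\<Omega> by auto
        then show "ennreal (rh (T x) * (s x - e * v x) * (x - T x)\<^sup>2) + ennreal ((1 - rh (T x)) * (s x - e * v x) * (x - T x)\<^sup>2)
          = ennreal ((s x - e * v x) * (x - T x)\<^sup>2)"
          by (simp add: algebra_simps flip: ennreal_plus)
      qed
      finally have W': "W' \<le> ?C'" .
      have "?C' + ennreal e * D = (\<integral>\<^sup>+x. ennreal ((s x - e * v x) * (x - T x)\<^sup>2) + ennreal e * ennreal (v x * (x - T x)\<^sup>2) \<partial>?L)"
        unfolding D_def by (simp add: nn_integral_add nn_integral_cmult)
      also have "\<dots> = C"
        unfolding C_def
      proof (rule nn_integral_cong)
        fix x assume "x \<in> space ?L"
        then have "0 \<le> (s x - e * v x) * (x - T x)\<^sup>2" "0 \<le> v x * (x - T x)\<^sup>2"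
          using ev v0 by auto
        then show "ennreal ((s x - e * v x) * (x - T x)\<^sup>2) + ennreal e * ennreal (v x * (x - T x)\<^sup>2) = ennreal (s x * (x - T x)\<^sup>2)"
          using e by (simp add: algebra_simps flip: ennreal_plus ennreal_mult)
      qed
      finally have C': "?C' + ennreal e * D = C" .
      have "?C' \<noteq> top" using C' c by auto
      then obtain c' where c': "0 \<le> c'" "?C' = ennreal c'" by (cases ?C') auto
      have cc: "c' + e * d = c"
        using C' c c' d e by (simp flip: ennreal_mult ennreal_plus)
      obtain w' where w': "0 \<le> w'" "W' = ennreal w'" "w' \<le> c'"
        using W' c' by (cases W') (auto simp: top_unique)

      let ?p = "dchi ((1 - e) * M)" and ?q = "dchi ((1 + e) * M)"
      have p0: "0 \<le> ?p" "0 \<le> ?q" using e M by (auto intro!: dchi_nonneg)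
      have f0: "0 \<le> f x" if "x \<in> \<Omega>" for x using ev[OF that] u0[of x] e by (simp add: f_def)
      have [measurable]: "f \<in> borel_measurable ?L" unfolding f_def by measurable
      have [measurable]: "(\<lambda>x. ennreal (chi (f x) - chi 0)) \<in> borel_measurable ?L"
        "(\<lambda>x. ennreal (chi (s x) - chi 0)) \<in> borel_measurable ?L"
        using chi_int[OF refl, of f] chi_int[OF refl, of s] f0 s0 by auto
      have "?I' + ennreal (e * ?p) * ennreal m = (\<integral>\<^sup>+x. ennreal (chi (f x) - chi 0) + ennreal (e * ?p) * ennreal (v x) \<partial>?L)"
        by (simp add: nn_integral_add nn_integral_cmult m(2))
      also have "\<dots> \<le> (\<integral>\<^sup>+x. ennreal (chi (s x) - chi 0) + ennreal (e * ?q) * ennreal (u x) \<partial>?L)"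
      proof (rule nn_integral_mono_AE)
        show "AE x in ?L. ennreal (chi (f x) - chi 0) + ennreal (e * ?p) * ennreal (v x)
          \<le> ennreal (chi (s x) - chi 0) + ennreal (e * ?q) * ennreal (u x)"
          using uM uA AE_space
        proof eventually_elim
          case (elim x)
          then have x: "x \<in> \<Omega>" by simp
          have "chi (f x) + e * ?p * v x \<le> chi (s x) + e * ?q * u x"
            unfolding f_def using elim e M s0[OF x] u0[of x] x
            by (intro chi_competitor_le) (auto simp: v_def B_def indicator_def)
          moreover have "chi 0 \<le> chi (f x)" "chi 0 \<le> chi (s x)" using f0 s0 x by (auto intro: chi_mono)
          ultimately show ?case
            using e p0 v0[OF x] u0[of x] by (simp flip: ennreal_mult ennreal_plus)
        qed
      qed
      also have "\<dots> = I + ennreal (e * ?q) * ennreal m"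
        by (simp add: nn_integral_add nn_integral_cmult mu I_def)
      finally have II: "?I' + ennreal (e * ?p) * ennreal m \<le> I + ennreal (e * ?q) * ennreal m" .
      then have "?I' \<noteq> top" using i p0 e m by (auto simp: top_unique simp flip: ennreal_mult ennreal_plus)
      then obtain i' where i': "0 \<le> i'" "?I' = ennreal i'" by (cases ?I') auto
      have ii: "i' + e * ?p * m \<le> i + e * ?q * m"
        using II i i' p0 e m(1) by (simp flip: ennreal_mult ennreal_plus)

      have Pf: "P rh x + P (\<lambda>x. 1 - rh x) x = f x" for x by (simp add: P_def f_def algebra_simps)
      have "energy \<Omega> chi (dens \<Omega> (P rh)) (dens \<Omega> (P (\<lambda>x. 1 - rh x))) = ereal k
        + enn2ereal (\<integral>\<^sup>+x. ennreal (chi (P rh x + P (\<lambda>x. 1 - rh x) x) - chi 0) \<partial>?L)"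
        unfolding k_def
        by (intro energy_dens \<Omega>) (use ev nn u0 e T\<Omega> in \<open>auto simp: P_def intro!: add_nonneg_nonneg mult_nonneg_nonneg\<close>)
      then have jko_P: "jko \<Omega> chi \<tau> (dens \<Omega> ?ph) (dens \<Omega> ?eh) (dens \<Omega> (P rh)) (dens \<Omega> (P (\<lambda>x. 1 - rh x)))
        = ereal (1 / (2 * \<tau>)) * enn2ereal W' + (ereal k + enn2ereal ?I')"
        unfolding jko_def W'_def Pf by (simp only:)
      have "dens \<Omega> (P rh) \<in> meas_on \<Omega> (\<integral>\<^sup>+x. ennreal (?ph x) \<partial>?L)"
        "dens \<Omega> (P (\<lambda>x. 1 - rh x)) \<in> meas_on \<Omega> (\<integral>\<^sup>+x. ennreal (?eh x) \<partial>?L)"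
        using nn by (auto intro!: comp)
      from min[OF this] have "ereal (1 / (2 * \<tau>)) * enn2ereal W + (ereal k + enn2ereal I)
        \<le> ereal (1 / (2 * \<tau>)) * enn2ereal W' + (ereal k + enn2ereal ?I')"
        unfolding jko_min jko_P .
      then have "w / (2 * \<tau>) + i \<le> w' / (2 * \<tau>) + i'"
        using w i w' i' by simp
      moreover have "(c' + e * d) / (2 * \<tau>) \<le> w / (2 * \<tau>)" "w' / (2 * \<tau>) \<le> c' / (2 * \<tau>)"
        using \<tau> c(3) cc w'(3) by (auto intro!: divide_right_mono)
      ultimately have "e * d / (2 * \<tau>) \<le> i' - i" by (simp add: add_divide_distrib)
      also have "\<dots> \<le> e * ((?q - ?p) * m)" using ii by (simp add: algebra_simps)
      finally have "e * (d / (2 * \<tau>)) \<le> e * ((?q - ?p) * m)" by simp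
      then have "d / (2 * \<tau>) \<le> (?q - ?p) * m" using e by (simp only: mult_le_cancel_left_pos)
      then show ?thesis using \<tau> by (simp add: field_simps)
    qed
    have "isCont dchi M" using chi_d2[OF M] by (rule DERIV_isCont)
    then have "((\<lambda>e. dchi ((1 + e) * M)) \<longlongrightarrow> dchi M) (at_right 0)" "((\<lambda>e. dchi ((1 - e) * M)) \<longlongrightarrow> dchi M) (at_right 0)"
      by (auto intro!: isCont_tendsto_compose[of M dchi] tendsto_eq_intros)
    then have "((\<lambda>e. 2 * \<tau> * m * (dchi ((1 + e) * M) - dchi ((1 - e) * M))) \<longlongrightarrow> 2 * \<tau> * m * (dchi M - dchi M)) (at_right 0)"
      by (intro tendsto_intros)
    then have "d \<le> 2 * \<tau> * m * (dchi M - dchi M)"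
    proof (rule tendsto_lowerbound)
      show "\<forall>\<^sub>F e in at_right 0. d \<le> 2 * \<tau> * m * (dchi ((1 + e) * M) - dchi ((1 - e) * M))"
        using key by (auto simp: eventually_at_right_field intro!: exI[of _ 1])
    qed simp
    then show ?thesis using d False by simp
  qed
qed

end

section \<open>The reaction flow\<close>

lemma increment_le:
  fixes f :: "real \<Rightarrow> real"
  assumes "0 \<le> \<tau>"
    and d: "\<And>t. t \<in> {0..\<tau>} \<Longrightarrow> (f has_real_derivative f' t) (at t within {0..\<tau>})"
    and le: "\<And>t. t \<in> {0..\<tau>} \<Longrightarrow> f' t \<le> B"
  shows "f \<tau> \<le> f 0 + B * \<tau>"
proof -
  have "B * 0 - f 0 \<le> B * \<tau> - f \<tau>"
  proof (rule DERIV_nonneg_imp_increasing_open[OF \<open>0 \<le> \<tau>\<close>])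
    fix t assume t: "0 < t" "t < \<tau>"
    then have "(f has_real_derivative f' t) (at t)"
      using d[of t] by (simp add: at_within_Icc_at)
    then have "((\<lambda>t. B * t - f t) has_real_derivative B - f' t) (at t)"
      by (auto intro!: derivative_eq_intros)
    then show "\<exists>y. ((\<lambda>t. B * t - f t) has_real_derivative y) (at t) \<and> 0 \<le> y"
      using le[of t] t by auto
    next
    have "continuous_on {0..\<tau>} f" using d by (rule DERIV_continuous_on)
    then show "continuous_on {0..\<tau>} (\<lambda>t. B * t - f t)" by (intro continuous_intros)
  qed
  then show ?thesis by simp
qed

lemma gronwall:
  fixes f :: "real \<Rightarrow> real"
  assumes "0 \<le> \<tau>"
    and d: "\<And>t. t \<in> {0..\<tau>} \<Longrightarrow> (f has_real_derivative f' t) (at t within {0..\<tau>})"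
    and le: "\<And>t. t \<in> {0..\<tau>} \<Longrightarrow> f' t \<le> A * f t"
  shows "f \<tau> \<le> f 0 * exp (A * \<tau>)"
proof -
  have "f \<tau> * exp (- A * \<tau>) \<le> f 0 * exp (- A * 0) + 0 * \<tau>"
  proof (rule increment_le[OF \<open>0 \<le> \<tau>\<close>])
    fix t assume t: "t \<in> {0..\<tau>}"
    show "((\<lambda>t. f t * exp (- A * t)) has_real_derivative (f' t - A * f t) * exp (- A * t)) (at t within {0..\<tau>})"
      by (rule derivative_eq_intros refl d[OF t])+ (simp add: algebra_simps)
    show "(f' t - A * f t) * exp (- A * t) \<le> 0"
      using le[OF t] by (intro mult_nonpos_nonneg) auto
  qed
  then show ?thesis by (simp add: exp_minus field_simps)
qed

definition bdd_lip :: "real \<Rightarrow> (real \<Rightarrow> real \<Rightarrow> real) \<Rightarrow> bool" where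
  "bdd_lip S f \<longleftrightarrow> (\<exists>C\<ge>0. \<forall>x\<in>{0..S}. \<forall>y\<in>{0..S}. \<forall>r\<in>{0..1}. \<forall>q\<in>{0..1}.
     \<bar>f x r\<bar> \<le> C \<and> \<bar>f x r - f y q\<bar> \<le> C * (\<bar>x - y\<bar> + \<bar>r - q\<bar>))"

lemma bdd_lipE:
  assumes "bdd_lip S f"
  obtains C where "0 \<le> C" "\<And>x r. 0 \<le> x \<Longrightarrow> x \<le> S \<Longrightarrow> 0 \<le> r \<Longrightarrow> r \<le> 1 \<Longrightarrow> \<bar>f x r\<bar> \<le> C"
    "\<And>x y r q. 0 \<le> x \<Longrightarrow> x \<le> S \<Longrightarrow> 0 \<le> y \<Longrightarrow> y \<le> S \<Longrightarrow> 0 \<le> r \<Longrightarrow> r \<le> 1 \<Longrightarrow> 0 \<le> q \<Longrightarrow> q \<le> 1 \<Longrightarrow>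
      \<bar>f x r - f y q\<bar> \<le> C * (\<bar>x - y\<bar> + \<bar>r - q\<bar>)"
  using assms unfolding bdd_lip_def by (metis atLeastAtMost_iff)

lemma bdd_lipI:
  assumes C: "\<And>x r. 0 \<le> x \<Longrightarrow> x \<le> S \<Longrightarrow> 0 \<le> r \<Longrightarrow> r \<le> 1 \<Longrightarrow> \<bar>f x r\<bar> \<le> C"
    and D: "\<And>x y r q. 0 \<le> x \<Longrightarrow> x \<le> S \<Longrightarrow> 0 \<le> y \<Longrightarrow> y \<le> S \<Longrightarrow> 0 \<le> r \<Longrightarrow> r \<le> 1 \<Longrightarrow> 0 \<le> q \<Longrightarrow> q \<le> 1 \<Longrightarrow>
      \<bar>f x r - f y q\<bar> \<le> D * (\<bar>x - y\<bar> + \<bar>r - q\<bar>)"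
  shows "bdd_lip S f"
  unfolding bdd_lip_def
proof (intro exI[of _ "max 0 (max C D)"] conjI ballI)
  fix x y r q assume h: "x \<in> {0..S}" "y \<in> {0..S}" "r \<in> {0..1::real}" "q \<in> {0..1::real}"
  show "\<bar>f x r\<bar> \<le> max 0 (max C D)" using C[of x r] h by auto
  have "\<bar>f x r - f y q\<bar> \<le> D * (\<bar>x - y\<bar> + \<bar>r - q\<bar>)" using D[of x y r q] h by auto
  also have "\<dots> \<le> max 0 (max C D) * (\<bar>x - y\<bar> + \<bar>r - q\<bar>)" by (intro mult_right_mono) auto
  finally show "\<bar>f x r - f y q\<bar> \<le> max 0 (max C D) * (\<bar>x - y\<bar> + \<bar>r - q\<bar>)" .
qed simp

lemma bdd_lip_const: "bdd_lip S (\<lambda>x r. c)"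
  by (rule bdd_lipI[of _ _ "\<bar>c\<bar>" 0]) auto

lemma bdd_lip_fst: "bdd_lip S (\<lambda>x r. x)"
  by (rule bdd_lipI[of _ _ S 1]) auto

lemma bdd_lip_snd: "bdd_lip S (\<lambda>x r. r)"
  by (rule bdd_lipI[of _ _ 1 1]) auto

lemma bdd_lip_add:
  assumes "bdd_lip S f" "bdd_lip S g"
  shows "bdd_lip S (\<lambda>x r. f x r + g x r)"
proof -
  obtain C where C: "0 \<le> C" "\<And>x r. 0 \<le> x \<Longrightarrow> x \<le> S \<Longrightarrow> 0 \<le> r \<Longrightarrow> r \<le> 1 \<Longrightarrow> \<bar>f x r\<bar> \<le> C"
    "\<And>x y r q. 0 \<le> x \<Longrightarrow> x \<le> S \<Longrightarrow> 0 \<le> y \<Longrightarrow> y \<le> S \<Longrightarrow> 0 \<le> r \<Longrightarrow> r \<le> 1 \<Longrightarrow> 0 \<le> q \<Longrightarrow> q \<le> 1 \<Longrightarrow>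
      \<bar>f x r - f y q\<bar> \<le> C * (\<bar>x - y\<bar> + \<bar>r - q\<bar>)"
    using bdd_lipE[OF assms(1)] by metis
  obtain D where D: "0 \<le> D" "\<And>x r. 0 \<le> x \<Longrightarrow> x \<le> S \<Longrightarrow> 0 \<le> r \<Longrightarrow> r \<le> 1 \<Longrightarrow> \<bar>g x r\<bar> \<le> D"
    "\<And>x y r q. 0 \<le> x \<Longrightarrow> x \<le> S \<Longrightarrow> 0 \<le> y \<Longrightarrow> y \<le> S \<Longrightarrow> 0 \<le> r \<Longrightarrow> r \<le> 1 \<Longrightarrow> 0 \<le> q \<Longrightarrow> q \<le> 1 \<Longrightarrow>
      \<bar>g x r - g y q\<bar> \<le> D * (\<bar>x - y\<bar> + \<bar>r - q\<bar>)"
    using bdd_lipE[OF assms(2)] by metis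
  show ?thesis
  proof (rule bdd_lipI)
    fix x r assume h: "0 \<le> x" "x \<le> S" "0 \<le> r" "r \<le> (1::real)"
    show "\<bar>f x r + g x r\<bar> \<le> C + D" using C(2)[OF h] D(2)[OF h] by linarith
  next
    fix x y r q assume h: "0 \<le> x" "x \<le> S" "0 \<le> y" "y \<le> S" "0 \<le> r" "r \<le> (1::real)" "0 \<le> q" "q \<le> (1::real)"
    show "\<bar>f x r + g x r - (f y q + g y q)\<bar> \<le> (C + D) * (\<bar>x - y\<bar> + \<bar>r - q\<bar>)"
      using C(3)[OF h] D(3)[OF h] unfolding distrib_right[of C D] by linarith
  qed
qed

lemma bdd_lip_mult:
  assumes "bdd_lip S f" "bdd_lip S g"
  shows "bdd_lip S (\<lambda>x r. f x r * g x r)"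
proof -
  obtain C where C: "0 \<le> C" "\<And>x r. 0 \<le> x \<Longrightarrow> x \<le> S \<Longrightarrow> 0 \<le> r \<Longrightarrow> r \<le> 1 \<Longrightarrow> \<bar>f x r\<bar> \<le> C"
    "\<And>x y r q. 0 \<le> x \<Longrightarrow> x \<le> S \<Longrightarrow> 0 \<le> y \<Longrightarrow> y \<le> S \<Longrightarrow> 0 \<le> r \<Longrightarrow> r \<le> 1 \<Longrightarrow> 0 \<le> q \<Longrightarrow> q \<le> 1 \<Longrightarrow>
      \<bar>f x r - f y q\<bar> \<le> C * (\<bar>x - y\<bar> + \<bar>r - q\<bar>)"
    using bdd_lipE[OF assms(1)] by metis
  obtain D where D: "0 \<le> D" "\<And>x r. 0 \<le> x \<Longrightarrow> x \<le> S \<Longrightarrow> 0 \<le> r \<Longrightarrow> r \<le> 1 \<Longrightarrow> \<bar>g x r\<bar> \<le> D"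
    "\<And>x y r q. 0 \<le> x \<Longrightarrow> x \<le> S \<Longrightarrow> 0 \<le> y \<Longrightarrow> y \<le> S \<Longrightarrow> 0 \<le> r \<Longrightarrow> r \<le> 1 \<Longrightarrow> 0 \<le> q \<Longrightarrow> q \<le> 1 \<Longrightarrow>
      \<bar>g x r - g y q\<bar> \<le> D * (\<bar>x - y\<bar> + \<bar>r - q\<bar>)"
    using bdd_lipE[OF assms(2)] by metis
  show ?thesis
  proof (rule bdd_lipI)
    fix x r assume h: "0 \<le> x" "x \<le> S" "0 \<le> r" "r \<le> (1::real)"
    show "\<bar>f x r * g x r\<bar> \<le> C * D"
      unfolding abs_mult using C(1) C(2)[OF h] D(2)[OF h] by (intro mult_mono) auto
  next
    fix x y r q assume h: "0 \<le> x" "x \<le> S" "0 \<le> y" "y \<le> S" "0 \<le> r" "r \<le> (1::real)" "0 \<le> q" "q \<le> (1::real)"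
    have "\<bar>f x r * g x r - f y q * g y q\<bar> = \<bar>f x r * (g x r - g y q) + (f x r - f y q) * g y q\<bar>"
      by (simp add: algebra_simps)
    also have "\<dots> \<le> \<bar>f x r\<bar> * \<bar>g x r - g y q\<bar> + \<bar>f x r - f y q\<bar> * \<bar>g y q\<bar>"
      unfolding abs_mult[symmetric] by (rule abs_triangle_ineq)
    also have "\<dots> \<le> C * (D * (\<bar>x - y\<bar> + \<bar>r - q\<bar>)) + (C * (\<bar>x - y\<bar> + \<bar>r - q\<bar>)) * D"
      using C(1) C(2)[of x r] D(2)[of y q] C(3)[OF h] D(3)[OF h] h
      by (intro add_mono mult_mono) auto
    also have "\<dots> = (2 * C * D) * (\<bar>x - y\<bar> + \<bar>r - q\<bar>)" by (simp add: algebra_simps)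
    finally show "\<bar>f x r * g x r - f y q * g y q\<bar> \<le> (2 * C * D) * (\<bar>x - y\<bar> + \<bar>r - q\<bar>)" .
  qed
qed

lemma bdd_lip_diff:
  assumes "bdd_lip S f" "bdd_lip S g"
  shows "bdd_lip S (\<lambda>x r. f x r - g x r)"
  using bdd_lip_add[OF assms(1) bdd_lip_mult[OF bdd_lip_const[of _ "-1"] assms(2)]] by simp

definition reaction_solution ::
  "(real \<Rightarrow> real \<Rightarrow> real) \<Rightarrow> (real \<Rightarrow> real \<Rightarrow> real) \<Rightarrow> (real \<Rightarrow> real \<Rightarrow> real) \<Rightarrow>
    (real \<Rightarrow> real \<Rightarrow> real) \<Rightarrow> real \<Rightarrow> (real \<Rightarrow> real) \<Rightarrow> (real \<Rightarrow> real) \<Rightarrow> bool" where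
  "reaction_solution F1 F2 G1 G2 \<tau> s q \<longleftrightarrow> (\<forall>t\<in>{0..\<tau>}. 0 \<le> s t \<and> 0 \<le> q t \<and> q t \<le> 1 \<and>
     (s has_real_derivative SigmaR F1 F2 G1 G2 (s t) (q t)) (at t within {0..\<tau>}) \<and>
     (q has_real_derivative Rfun F1 F2 G1 G2 (s t) (q t)) (at t within {0..\<tau>}))"

locale reaction_rates =
  fixes F1 F2 G1 G2 :: "real \<Rightarrow> real \<Rightarrow> real" and M L :: real
  assumes rates_bounded: "\<And>x y. 0 \<le> x \<Longrightarrow> 0 \<le> y \<Longrightarrow>
      \<bar>F1 x y\<bar> \<le> M \<and> \<bar>F2 x y\<bar> \<le> M \<and> \<bar>G1 x y\<bar> \<le> M \<and> \<bar>G2 x y\<bar> \<le> M"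
    and rates_lipschitz: "\<And>x1 y1 x2 y2. 0 \<le> x1 \<Longrightarrow> 0 \<le> y1 \<Longrightarrow> 0 \<le> x2 \<Longrightarrow> 0 \<le> y2 \<Longrightarrow>
      \<bar>F1 x1 y1 - F1 x2 y2\<bar> \<le> L * (\<bar>x1 - x2\<bar> + \<bar>y1 - y2\<bar>) \<and>
      \<bar>F2 x1 y1 - F2 x2 y2\<bar> \<le> L * (\<bar>x1 - x2\<bar> + \<bar>y1 - y2\<bar>) \<and>
      \<bar>G1 x1 y1 - G1 x2 y2\<bar> \<le> L * (\<bar>x1 - x2\<bar> + \<bar>y1 - y2\<bar>) \<and>
      \<bar>G2 x1 y1 - G2 x2 y2\<bar> \<le> L * (\<bar>x1 - x2\<bar> + \<bar>y1 - y2\<bar>)"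
begin

lemma M_nonneg: "0 \<le> M"
  using rates_bounded[of 0 0] by linarith

definition growth :: "real \<Rightarrow> real \<Rightarrow> real" where
  "growth s r = r * (til F1 s r + til G2 s r) + (1 - r) * (til G1 s r + til F2 s r)"

lemma SigmaR_growth: "SigmaR F1 F2 G1 G2 s r = s * growth s r"
  by (simp add: SigmaR_def growth_def)

lemma abs_growth_le:
  assumes "0 \<le> s" "0 \<le> r" "r \<le> 1"
  shows "\<bar>growth s r\<bar> \<le> 2 * M"
proof -
  have b: "\<bar>til F1 s r + til G2 s r\<bar> \<le> 2 * M" "\<bar>til G1 s r + til F2 s r\<bar> \<le> 2 * M"
    using rates_bounded[of "r * s" "(1 - r) * s"] assms unfolding til_def by auto
  have "\<bar>growth s r\<bar> \<le> \<bar>r * (til F1 s r + til G2 s r)\<bar> + \<bar>(1 - r) * (til G1 s r + til F2 s r)\<bar>"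
    unfolding growth_def by (rule abs_triangle_ineq)
  also have "\<dots> \<le> r * (2 * M) + (1 - r) * (2 * M)"
    unfolding abs_mult using b assms by (intro add_mono mult_mono) auto
  finally show ?thesis by (simp add: algebra_simps)
qed

lemma bdd_lip_til:
  assumes bdd: "\<And>x y. 0 \<le> x \<Longrightarrow> 0 \<le> y \<Longrightarrow> \<bar>F x y\<bar> \<le> M"
    and lip: "\<And>x1 y1 x2 y2. 0 \<le> x1 \<Longrightarrow> 0 \<le> y1 \<Longrightarrow> 0 \<le> x2 \<Longrightarrow> 0 \<le> y2 \<Longrightarrow>
      \<bar>F x1 y1 - F x2 y2\<bar> \<le> L * (\<bar>x1 - x2\<bar> + \<bar>y1 - y2\<bar>)"
  shows "bdd_lip S (til F)"
proof -
  obtain C where C: "\<And>x y r q. 0 \<le> x \<Longrightarrow> x \<le> S \<Longrightarrow> 0 \<le> y \<Longrightarrow> y \<le> S \<Longrightarrow> 0 \<le> r \<Longrightarrow> r \<le> 1 \<Longrightarrow> 0 \<le> q \<Longrightarrow> q \<le> 1 \<Longrightarrow>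
      \<bar>r * x - q * y\<bar> \<le> C * (\<bar>x - y\<bar> + \<bar>r - q\<bar>)"
    using bdd_lipE[OF bdd_lip_mult[OF bdd_lip_snd bdd_lip_fst, of S]] by metis
  obtain D where D: "\<And>x y r q. 0 \<le> x \<Longrightarrow> x \<le> S \<Longrightarrow> 0 \<le> y \<Longrightarrow> y \<le> S \<Longrightarrow> 0 \<le> r \<Longrightarrow> r \<le> 1 \<Longrightarrow> 0 \<le> q \<Longrightarrow> q \<le> 1 \<Longrightarrow>
      \<bar>(1 - r) * x - (1 - q) * y\<bar> \<le> D * (\<bar>x - y\<bar> + \<bar>r - q\<bar>)"
    using bdd_lipE[OF bdd_lip_mult[OF bdd_lip_diff[OF bdd_lip_const[of _ 1] bdd_lip_snd] bdd_lip_fst, of S]] by metis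
  show ?thesis
  proof (rule bdd_lipI)
    fix x r assume "0 \<le> x" "x \<le> S" "0 \<le> r" "r \<le> (1::real)"
    then show "\<bar>til F x r\<bar> \<le> M" unfolding til_def by (intro bdd) auto
  next
    fix x y r q assume h: "0 \<le> x" "x \<le> S" "0 \<le> y" "y \<le> S" "0 \<le> r" "r \<le> (1::real)" "0 \<le> q" "q \<le> (1::real)"
    have "\<bar>til F x r - til F y q\<bar> \<le> L * (\<bar>r * x - q * y\<bar> + \<bar>(1 - r) * x - (1 - q) * y\<bar>)"
      unfolding til_def using h by (intro lip) auto
    also have "\<dots> \<le> \<bar>L\<bar> * (\<bar>r * x - q * y\<bar> + \<bar>(1 - r) * x - (1 - q) * y\<bar>)"
      by (intro mult_right_mono) auto
    also have "\<dots> \<le> \<bar>L\<bar> * ((C + D) * (\<bar>x - y\<bar> + \<bar>r - q\<bar>))"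
      using C[OF h] D[OF h] by (intro mult_left_mono) (auto simp: algebra_simps)
    finally show "\<bar>til F x r - til F y q\<bar> \<le> \<bar>L\<bar> * (C + D) * (\<bar>x - y\<bar> + \<bar>r - q\<bar>)" by simp
  qed
qed

lemma bdd_lip_reaction: "bdd_lip S (SigmaR F1 F2 G1 G2)" "bdd_lip S (Rfun F1 F2 G1 G2)"
proof -
  have t: "bdd_lip S (til F1)" "bdd_lip S (til F2)" "bdd_lip S (til G1)" "bdd_lip S (til G2)"
    using rates_bounded rates_lipschitz by (auto intro!: bdd_lip_til)
  show "bdd_lip S (SigmaR F1 F2 G1 G2)" "bdd_lip S (Rfun F1 F2 G1 G2)"
    unfolding SigmaR_def[abs_def] Rfun_def[abs_def] power2_eq_square
    by (intro bdd_lip_add bdd_lip_mult bdd_lip_diff bdd_lip_const bdd_lip_fst bdd_lip_snd t)+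
qed

lemma reaction_solution_mono:
  assumes "reaction_solution F1 F2 G1 G2 \<tau> s q" "t \<le> \<tau>"
  shows "reaction_solution F1 F2 G1 G2 t s q"
proof -
  have "{0..t} \<subseteq> {0..\<tau>}" using assms(2) by auto
  then show ?thesis
    using assms(1) unfolding reaction_solution_def by (meson has_field_derivative_subset subsetD)
qed

lemma reaction_growth:
  assumes sol: "reaction_solution F1 F2 G1 G2 \<tau> s q" and "0 \<le> \<tau>"
  shows "s \<tau> \<le> s 0 * exp (2 * M * \<tau>)" "s 0 \<le> s \<tau> * exp (2 * M * \<tau>)"
proof -
  have d: "(s has_real_derivative s t * growth (s t) (q t)) (at t within {0..\<tau>})"
    and g: "\<bar>growth (s t) (q t)\<bar> \<le> 2 * M" and s: "0 \<le> s t" if "t \<in> {0..\<tau>}" for t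
    using sol that by (auto simp: reaction_solution_def SigmaR_growth intro: abs_growth_le)
  show "s \<tau> \<le> s 0 * exp (2 * M * \<tau>)"
  proof (rule gronwall[OF \<open>0 \<le> \<tau>\<close> d])
    fix t assume t: "t \<in> {0..\<tau>}"
    have "s t * growth (s t) (q t) \<le> s t * (2 * M)"
      using g[OF t] s[OF t] by (intro mult_left_mono) auto
    then show "s t * growth (s t) (q t) \<le> 2 * M * s t" by (simp add: mult.commute)
  qed
  have "- s \<tau> \<le> - s 0 * exp (- (2 * M) * \<tau>)"
  proof (rule gronwall[OF \<open>0 \<le> \<tau>\<close>])
    fix t assume t: "t \<in> {0..\<tau>}"
    show "((\<lambda>t. - s t) has_real_derivative - (s t * growth (s t) (q t))) (at t within {0..\<tau>})"
      using d[OF t] by (rule DERIV_minus)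
    have "s t * (- (2 * M)) \<le> s t * growth (s t) (q t)"
      using g[OF t] s[OF t] by (intro mult_left_mono) auto
    then show "- (s t * growth (s t) (q t)) \<le> - (2 * M) * - s t" by (simp add: mult.commute)
  qed
  then show "s 0 \<le> s \<tau> * exp (2 * M * \<tau>)" by (simp add: exp_minus field_simps)
qed

lemma reaction_flow_lipschitz:
  assumes "0 \<le> \<tau>"
  obtains C where "0 \<le> C" "\<And>s q s' q'. reaction_solution F1 F2 G1 G2 \<tau> s q \<Longrightarrow>
    reaction_solution F1 F2 G1 G2 \<tau> s' q' \<Longrightarrow> s 0 \<le> k \<Longrightarrow> s' 0 \<le> k \<Longrightarrow>
    \<bar>s \<tau> - s' \<tau>\<bar> \<le> C * (\<bar>s 0 - s' 0\<bar> + \<bar>q 0 - q' 0\<bar>) \<and>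
    \<bar>q \<tau> - q' \<tau>\<bar> \<le> C * (\<bar>s 0 - s' 0\<bar> + \<bar>q 0 - q' 0\<bar>)"
proof -
  define S where "S = max 0 k * exp (2 * M * \<tau>)"
  obtain C where C: "0 \<le> C" "\<And>x y r q. 0 \<le> x \<Longrightarrow> x \<le> S \<Longrightarrow> 0 \<le> y \<Longrightarrow> y \<le> S \<Longrightarrow> 0 \<le> r \<Longrightarrow> r \<le> 1 \<Longrightarrow> 0 \<le> q \<Longrightarrow> q \<le> 1 \<Longrightarrow>
      \<bar>SigmaR F1 F2 G1 G2 x r - SigmaR F1 F2 G1 G2 y q\<bar> \<le> C * (\<bar>x - y\<bar> + \<bar>r - q\<bar>)"
    using bdd_lipE[OF bdd_lip_reaction(1)[of S]] by metis
  obtain D where D: "0 \<le> D" "\<And>x y r q. 0 \<le> x \<Longrightarrow> x \<le> S \<Longrightarrow> 0 \<le> y \<Longrightarrow> y \<le> S \<Longrightarrow> 0 \<le> r \<Longrightarrow> r \<le> 1 \<Longrightarrow> 0 \<le> q \<Longrightarrow> q \<le> 1 \<Longrightarrow>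
      \<bar>Rfun F1 F2 G1 G2 x r - Rfun F1 F2 G1 G2 y q\<bar> \<le> D * (\<bar>x - y\<bar> + \<bar>r - q\<bar>)"
    using bdd_lipE[OF bdd_lip_reaction(2)[of S]] by metis
  define E where "E = C + D"
  show ?thesis
  proof (rule that[of "exp (2 * E * \<tau>)"])
    fix s q s' q'
    assume sol: "reaction_solution F1 F2 G1 G2 \<tau> s q" "reaction_solution F1 F2 G1 G2 \<tau> s' q'"
      and k: "s 0 \<le> k" "s' 0 \<le> k"
    have bd: "z t \<le> S" if z: "reaction_solution F1 F2 G1 G2 \<tau> z w" "z 0 \<le> k" and t: "t \<in> {0..\<tau>}" for z w t
    proof -
      have "z t \<le> z 0 * exp (2 * M * t)"
        using reaction_growth(1)[OF reaction_solution_mono[OF z(1)], of t] t by auto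
      also have "\<dots> \<le> S"
        unfolding S_def using z(2) t M_nonneg by (intro mult_mono) (auto intro!: mult_left_mono)
      finally show ?thesis .
    qed
    define U where "U t = (s t - s' t)\<^sup>2 + (q t - q' t)\<^sup>2" for t
    define a where "a t = s t - s' t" for t
    define b where "b t = q t - q' t" for t
    have "U \<tau> \<le> U 0 * exp (4 * E * \<tau>)"
    proof (rule gronwall[OF assms])
      fix t assume t: "t \<in> {0..\<tau>}"
      let ?A = "SigmaR F1 F2 G1 G2 (s t) (q t) - SigmaR F1 F2 G1 G2 (s' t) (q' t)"
      let ?B = "Rfun F1 F2 G1 G2 (s t) (q t) - Rfun F1 F2 G1 G2 (s' t) (q' t)"
      have r: "0 \<le> s t" "0 \<le> q t" "q t \<le> 1" "0 \<le> s' t" "0 \<le> q' t" "q' t \<le> 1"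
        "(s has_real_derivative SigmaR F1 F2 G1 G2 (s t) (q t)) (at t within {0..\<tau>})"
        "(q has_real_derivative Rfun F1 F2 G1 G2 (s t) (q t)) (at t within {0..\<tau>})"
        "(s' has_real_derivative SigmaR F1 F2 G1 G2 (s' t) (q' t)) (at t within {0..\<tau>})"
        "(q' has_real_derivative Rfun F1 F2 G1 G2 (s' t) (q' t)) (at t within {0..\<tau>})"
        using sol t by (auto simp: reaction_solution_def)
      show "(U has_real_derivative 2 * (a t * ?A) + 2 * (b t * ?B)) (at t within {0..\<tau>})"
        unfolding U_def a_def b_def by (rule derivative_eq_intros r refl)+ (simp add: algebra_simps)
      have A: "\<bar>?A\<bar> \<le> C * (\<bar>a t\<bar> + \<bar>b t\<bar>)" and B: "\<bar>?B\<bar> \<le> D * (\<bar>a t\<bar> + \<bar>b t\<bar>)"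
        unfolding a_def b_def using C(2) D(2) r bd[OF sol(1) k(1) t] bd[OF sol(2) k(2) t] by auto
      have "a t * ?A + b t * ?B \<le> \<bar>a t\<bar> * \<bar>?A\<bar> + \<bar>b t\<bar> * \<bar>?B\<bar>"
        unfolding abs_mult[symmetric] by (intro add_mono abs_ge_self)
      also have "\<dots> \<le> (\<bar>a t\<bar> + \<bar>b t\<bar>) * (C * (\<bar>a t\<bar> + \<bar>b t\<bar>)) + (\<bar>a t\<bar> + \<bar>b t\<bar>) * (D * (\<bar>a t\<bar> + \<bar>b t\<bar>))"
        using A B by (intro add_mono mult_mono) auto
      also have "\<dots> = E * (\<bar>a t\<bar> + \<bar>b t\<bar>)\<^sup>2" by (simp add: E_def power2_eq_square algebra_simps)
      also have "\<dots> \<le> E * (2 * (\<bar>a t\<bar>\<^sup>2 + \<bar>b t\<bar>\<^sup>2))"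
      proof (rule mult_left_mono)
        have "0 \<le> (\<bar>a t\<bar> - \<bar>b t\<bar>)\<^sup>2" by simp
        then show "(\<bar>a t\<bar> + \<bar>b t\<bar>)\<^sup>2 \<le> 2 * (\<bar>a t\<bar>\<^sup>2 + \<bar>b t\<bar>\<^sup>2)" by (simp add: power2_eq_square algebra_simps)
      qed (use C D in \<open>simp add: E_def\<close>)
      finally show "2 * (a t * ?A) + 2 * (b t * ?B) \<le> 4 * E * U t"
        by (simp add: U_def a_def b_def algebra_simps)
    qed
    also have "U 0 \<le> (\<bar>s 0 - s' 0\<bar> + \<bar>q 0 - q' 0\<bar>)\<^sup>2"
      by (simp add: U_def power2_sum)
    also have "exp (4 * E * \<tau>) = (exp (2 * E * \<tau>))\<^sup>2"
      by (simp add: power2_eq_square flip: exp_add)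
    finally have *: "U \<tau> \<le> (exp (2 * E * \<tau>) * (\<bar>s 0 - s' 0\<bar> + \<bar>q 0 - q' 0\<bar>))\<^sup>2"
      by (simp add: power_mult_distrib mult.commute)
    have sq: "\<bar>s \<tau> - s' \<tau>\<bar>\<^sup>2 \<le> U \<tau>" "\<bar>q \<tau> - q' \<tau>\<bar>\<^sup>2 \<le> U \<tau>" by (auto simp: U_def)
    have nn: "0 \<le> exp (2 * E * \<tau>) * (\<bar>s 0 - s' 0\<bar> + \<bar>q 0 - q' 0\<bar>)" by simp
    show "\<bar>s \<tau> - s' \<tau>\<bar> \<le> exp (2 * E * \<tau>) * (\<bar>s 0 - s' 0\<bar> + \<bar>q 0 - q' 0\<bar>) \<and>
      \<bar>q \<tau> - q' \<tau>\<bar> \<le> exp (2 * E * \<tau>) * (\<bar>s 0 - s' 0\<bar> + \<bar>q 0 - q' 0\<bar>)"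
      using power2_le_imp_le[OF order_trans[OF sq(1) *] nn] power2_le_imp_le[OF order_trans[OF sq(2) *] nn]
      by (rule conjI)
  qed simp
qed

end

text \<open>The hypothesis makes \<open>h\<close> a continuous function of \<open>(f, g)\<close> on the range of \<open>(f, g)\<close>,
  which need not be a Borel set.\<close>

lemma borel_measurable_if_locally_lipschitz:
  fixes f g h :: "'a \<Rightarrow> real"
  assumes [measurable]: "f \<in> borel_measurable N" "g \<in> borel_measurable N"
    and lip: "\<And>k. \<exists>C. \<forall>x\<in>space N. \<forall>y\<in>space N. f x \<le> k \<longrightarrow> f y \<le> k \<longrightarrow>
      \<bar>h x - h y\<bar> \<le> C * (\<bar>f x - f y\<bar> + \<bar>g x - g y\<bar>)"
  shows "h \<in> borel_measurable N"
proof -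
  define P where "P = (\<lambda>x. (f x, g x)) ` space N"
  define h' where "h' p = h (SOME x. x \<in> space N \<and> (f x, g x) = p)" for p
  have h': "h' (f x, g x) = h x" if x: "x \<in> space N" for x
  proof -
    define y where "y = (SOME y. y \<in> space N \<and> (f y, g y) = (f x, g x))"
    have "y \<in> space N \<and> (f y, g y) = (f x, g x)"
      unfolding y_def by (rule someI[of _ x]) (use x in auto)
    then have "\<bar>h y - h x\<bar> \<le> 0" using lip[of "f x"] x by fastforce
    then show ?thesis by (simp add: h'_def y_def)
  qed
  have "continuous_on P h'"
    unfolding continuous_on_iff
  proof safe
    fix a b e assume "(a, b) \<in> P" "0 < (e::real)"
    then obtain x where x: "x \<in> space N" "a = f x" "b = g x" by (auto simp: P_def)
    obtain C where C: "\<And>y z. y \<in> space N \<Longrightarrow> z \<in> space N \<Longrightarrow> f y \<le> f x + 1 \<Longrightarrow> f z \<le> f x + 1 \<Longrightarrow>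
      \<bar>h y - h z\<bar> \<le> C * (\<bar>f y - f z\<bar> + \<bar>g y - g z\<bar>)" using lip[of "f x + 1"] by blast
    define d where "d = min 1 (e / (2 * (\<bar>C\<bar> + 1)))"
    show "\<exists>d>0. \<forall>p\<in>P. dist p (a, b) < d \<longrightarrow> dist (h' p) (h' (a, b)) < e"
    proof (intro exI[of _ d] conjI ballI impI)
      show "0 < d" using \<open>0 < e\<close> by (auto simp: d_def)
      fix p assume "p \<in> P" and p: "dist p (a, b) < d"
      then obtain y where y: "y \<in> space N" "p = (f y, g y)" by (auto simp: P_def)
      have dd: "\<bar>f y - f x\<bar> < d" "\<bar>g y - g x\<bar> < d"
        using p dist_fst_le[of p "(a, b)"] dist_snd_le[of p "(a, b)"] x y by (auto simp: dist_real_def)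
      have "f y \<le> f x + 1" using dd(1) by (auto simp: d_def)
      then have "\<bar>h y - h x\<bar> \<le> C * (\<bar>f y - f x\<bar> + \<bar>g y - g x\<bar>)" using x y by (intro C) auto
      also have "\<dots> \<le> (\<bar>C\<bar> + 1) * (\<bar>f y - f x\<bar> + \<bar>g y - g x\<bar>)" by (intro mult_right_mono) auto
      also have "\<dots> < (\<bar>C\<bar> + 1) * (d + d)" using dd by (intro mult_strict_left_mono) auto
      also have "\<dots> \<le> (\<bar>C\<bar> + 1) * (2 * (e / (2 * (\<bar>C\<bar> + 1))))"
        by (intro mult_left_mono) (auto simp: d_def)
      also have "\<dots> = e" by (simp add: field_simps)
      finally show "dist (h' p) (h' (a, b)) < e" using x y by (simp add: h' dist_real_def)
    qed
  qed
  then have "h' \<in> borel_measurable (restrict_space borel P)"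
    by (rule borel_measurable_continuous_on_restrict)
  moreover have "(\<lambda>x. (f x, g x)) \<in> measurable N (restrict_space borel P)"
    by (intro measurable_restrict_space2) (auto simp: P_def)
  ultimately have "(\<lambda>x. h' (f x, g x)) \<in> borel_measurable N"
    by (rule measurable_compose[rotated])
  then show ?thesis by (rule measurable_cong[THEN iffD1, rotated]) (rule h')
qed

context reaction_rates
begin

lemma reaction_step:
  fixes sig r sigh rh :: "'a \<Rightarrow> real"
  assumes "0 \<le> \<tau>" and meas: "sig \<in> borel_measurable N" "r \<in> borel_measurable N"
    and sol: "\<And>x. x \<in> space N \<Longrightarrow> \<exists>s q. s 0 = sig x \<and> q 0 = r x \<and>
      reaction_solution F1 F2 G1 G2 \<tau> s q \<and> sigh x = s \<tau> \<and> rh x = q \<tau>"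
  shows "sigh \<in> borel_measurable N" "rh \<in> borel_measurable N"
    and "\<And>x. x \<in> space N \<Longrightarrow> 0 \<le> sigh x" "\<And>x. x \<in> space N \<Longrightarrow> 0 \<le> rh x" "\<And>x. x \<in> space N \<Longrightarrow> rh x \<le> 1"
    and "\<And>x. x \<in> space N \<Longrightarrow> sigh x \<le> sig x * exp (2 * M * \<tau>)"
proof -
  show "0 \<le> sigh x" "0 \<le> rh x" "rh x \<le> 1" "sigh x \<le> sig x * exp (2 * M * \<tau>)" if x: "x \<in> space N" for x
  proof -
    obtain s q where s: "s 0 = sig x" "q 0 = r x" "reaction_solution F1 F2 G1 G2 \<tau> s q" "sigh x = s \<tau>" "rh x = q \<tau>"
      using sol[OF x] by blast
    then show "0 \<le> sigh x" "0 \<le> rh x" "rh x \<le> 1" using \<open>0 \<le> \<tau>\<close> by (auto simp: reaction_solution_def)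
    show "sigh x \<le> sig x * exp (2 * M * \<tau>)" using reaction_growth(1)[OF s(3) \<open>0 \<le> \<tau>\<close>] s by simp
  qed
  have lip: "\<exists>C. \<forall>x\<in>space N. \<forall>y\<in>space N. sig x \<le> k \<longrightarrow> sig y \<le> k \<longrightarrow>
      \<bar>sigh x - sigh y\<bar> \<le> C * (\<bar>sig x - sig y\<bar> + \<bar>r x - r y\<bar>) \<and>
      \<bar>rh x - rh y\<bar> \<le> C * (\<bar>sig x - sig y\<bar> + \<bar>r x - r y\<bar>)" for k
  proof -
    obtain C where C: "\<And>s q s' q'. reaction_solution F1 F2 G1 G2 \<tau> s q \<Longrightarrow>
      reaction_solution F1 F2 G1 G2 \<tau> s' q' \<Longrightarrow> s 0 \<le> k \<Longrightarrow> s' 0 \<le> k \<Longrightarrow>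
      \<bar>s \<tau> - s' \<tau>\<bar> \<le> C * (\<bar>s 0 - s' 0\<bar> + \<bar>q 0 - q' 0\<bar>) \<and>
      \<bar>q \<tau> - q' \<tau>\<bar> \<le> C * (\<bar>s 0 - s' 0\<bar> + \<bar>q 0 - q' 0\<bar>)"
      using reaction_flow_lipschitz[OF \<open>0 \<le> \<tau>\<close>, of k] by metis
    show ?thesis
    proof (intro exI[of _ C] ballI impI)
      fix x y assume xy: "x \<in> space N" "y \<in> space N" "sig x \<le> k" "sig y \<le> k"
      obtain s q where s: "s 0 = sig x" "q 0 = r x" "reaction_solution F1 F2 G1 G2 \<tau> s q" "sigh x = s \<tau>" "rh x = q \<tau>"
        using sol[OF xy(1)] by blast
      obtain s' q' where s': "s' 0 = sig y" "q' 0 = r y" "reaction_solution F1 F2 G1 G2 \<tau> s' q'" "sigh y = s' \<tau>" "rh y = q' \<tau>"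
        using sol[OF xy(2)] by blast
      show "\<bar>sigh x - sigh y\<bar> \<le> C * (\<bar>sig x - sig y\<bar> + \<bar>r x - r y\<bar>) \<and>
        \<bar>rh x - rh y\<bar> \<le> C * (\<bar>sig x - sig y\<bar> + \<bar>r x - r y\<bar>)"
        using C[OF s(3) s'(3)] xy s s' by simp
    qed
  qed
  show "sigh \<in> borel_measurable N" "rh \<in> borel_measurable N"
    by (rule borel_measurable_if_locally_lipschitz[OF meas]; use lip in meson)+
qed

end

section \<open>The functional K along the reaction flow\<close>

locale entropy_density = energy_density +
  assumes chi_C2: "continuous_on {0<..} ddchi"
    and K_ex: "\<And>\<sigma>. \<sigma> \<ge> 0 \<Longrightarrow> interval_lebesgue_integrable lborel 0 (ereal \<sigma>) (kappa ddchi)"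
begin

lemma kappa_has_derivative:
  assumes "0 < x"
  shows "(kappa ddchi has_real_derivative ddchi x / x) (at x)"
proof -
  define a where "a = min 1 x / 2"
  define b where "b = max 1 x + 1"
  have ab: "0 < a" "a < x" "x < b" "a \<le> 1" "1 \<le> b" using assms by (auto simp: a_def b_def)
  have "continuous_on {a..b} (\<lambda>s. ddchi s / s)"
    using ab by (intro continuous_intros continuous_on_subset[OF chi_C2]) auto
  then have "((\<lambda>u. LBINT y=ereal 1..ereal u. ddchi y / y) has_vector_derivative ddchi x / x) (at x within {a..b})"
    using ab by (intro interval_integral_FTC2) auto
  then have "((\<lambda>u. LBINT y=ereal 1..ereal u. ddchi y / y) has_real_derivative ddchi x / x) (at x)"
    using ab by (simp add: has_real_derivative_iff_has_vector_derivative at_within_Icc_at)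
  then show ?thesis by (simp add: kappa_def[abs_def] one_ereal_def)
qed

lemma kappa_1: "kappa ddchi 1 = 0"
  by (simp add: kappa_def one_ereal_def interval_integral_endpoints_same)

lemma kappa_mono: "0 < x \<Longrightarrow> x \<le> y \<Longrightarrow> kappa ddchi x \<le> kappa ddchi y"
  using kappa_has_derivative chi_conv
  by (intro DERIV_nonneg_imp_nondecreasing[of x y "kappa ddchi"])
    (meson divide_pos_pos less_imp_le order_less_le_trans)+

lemma Kfun_has_derivative:
  assumes "0 < x"
  shows "(Kfun ddchi has_real_derivative kappa ddchi x) (at x)"
proof -
  define a where "a = x / 2"
  have a: "0 < a" "a < x" using assms by (auto simp: a_def)
  have "continuous_on {a..x + 1} (kappa ddchi)"
    using a kappa_has_derivative
    by (intro DERIV_continuous_on[where D="\<lambda>x. ddchi x / x"]) (auto intro: has_field_derivative_at_within)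
  then have "((\<lambda>u. LBINT y=ereal a..ereal u. kappa ddchi y) has_vector_derivative kappa ddchi x) (at x within {a..x + 1})"
    using a by (intro interval_integral_FTC2) auto
  then have "((\<lambda>u. LBINT y=ereal a..ereal u. kappa ddchi y) has_real_derivative kappa ddchi x) (at x)"
    using a by (simp add: has_real_derivative_iff_has_vector_derivative at_within_Icc_at)
  then have "((\<lambda>u. Kfun ddchi a + (LBINT y=ereal a..ereal u. kappa ddchi y)) has_real_derivative kappa ddchi x) (at x)"
    by (auto intro!: derivative_eq_intros)
  then show ?thesis
  proof (rule has_field_derivative_transform_within_open)
    show "open {a<..}" "x \<in> {a<..}" using a by auto
    fix u assume "u \<in> {a<..}"
    then have u: "a < u" by simp
    have "interval_lebesgue_integrable lborel (min 0 (min (ereal a) (ereal u))) (max 0 (max (ereal a) (ereal u))) (kappa ddchi)"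
      using K_ex[of u] a u by (simp add: min_def max_def zero_ereal_def)
    then show "Kfun ddchi a + (LBINT y=ereal a..ereal u. kappa ddchi y) = Kfun ddchi u"
      unfolding Kfun_def by (rule interval_integral_sum)
  qed
qed

lemma Kfun_bounded:
  obtains C where "\<And>s. 0 \<le> s \<Longrightarrow> s \<le> S \<Longrightarrow> \<bar>Kfun ddchi s\<bar> \<le> C"
proof (rule that)
  fix s assume s: "0 \<le> s" "s \<le> S"
  have int: "integrable lborel (\<lambda>x. indicator (einterval 0 (ereal y)) x *\<^sub>R kappa ddchi x)" if "0 \<le> y" for y
    using K_ex[OF that] that by (simp add: interval_lebesgue_integrable_def set_integrable_def)
  have "norm (\<integral>x. indicator (einterval 0 (ereal s)) x *\<^sub>R kappa ddchi x \<partial>lborel)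
    \<le> (\<integral>x. norm (indicator (einterval 0 (ereal S)) x *\<^sub>R kappa ddchi x) \<partial>lborel)"
  proof (rule Bochner_Integration.integral_norm_bound_integral[OF int integrable_norm[OF int]])
    fix x
    have "x \<in> einterval 0 (ereal s) \<Longrightarrow> x \<in> einterval 0 (ereal S)"
      using s by (auto simp: einterval_def)
    then show "norm (indicator (einterval 0 (ereal s)) x *\<^sub>R kappa ddchi x)
      \<le> norm (indicator (einterval 0 (ereal S)) x *\<^sub>R kappa ddchi x)"
      by (auto simp: indicator_def)
  qed (use s in auto)
  then show "\<bar>Kfun ddchi s\<bar> \<le> (\<integral>x. norm (indicator (einterval 0 (ereal S)) x *\<^sub>R kappa ddchi x) \<partial>lborel)"
    using s by (simp add: Kfun_def interval_lebesgue_integral_def set_lebesgue_integral_def)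
qed

lemma Kfun_borel_measurable:
  assumes [measurable]: "f \<in> borel_measurable N" and nn: "\<And>x. x \<in> space N \<Longrightarrow> 0 \<le> f x"
  shows "(\<lambda>x. Kfun ddchi (f x)) \<in> borel_measurable N"
proof -
  have "continuous_on {0<..} (Kfun ddchi)"
    using Kfun_has_derivative
    by (intro DERIV_continuous_on[where D="kappa ddchi"]) (auto intro: has_field_derivative_at_within)
  then have "(\<lambda>x. if x \<in> {0<..} then Kfun ddchi x else Kfun ddchi 0) \<in> borel_measurable borel"
    by (intro borel_measurable_continuous_on_if) auto
  from measurable_compose[OF assms(1) this]
  have "(\<lambda>x. if f x \<in> {0<..} then Kfun ddchi (f x) else Kfun ddchi 0) \<in> borel_measurable N" .
  also have "?this \<longleftrightarrow> ?thesis"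
    using nn by (intro measurable_cong) (force simp: not_less intro: antisym)
  finally show ?thesis .
qed

text \<open>Near \<open>0\<close> the possible singularity of \<open>kappa\<close> is compensated by the factor \<open>s\<close>:
  \<open>- s * kappa s \<le> dchi 1 - dchi s\<close> because \<open>s / x \<le> 1\<close> on \<open>[s, 1]\<close>.\<close>

lemma mult_kappa_bounded:
  assumes "1 \<le> S" "0 < s" "s \<le> S"
  shows "s * \<bar>kappa ddchi s\<bar> \<le> dchi 1 + S * kappa ddchi S"
proof -
  have S: "0 \<le> kappa ddchi S" using kappa_mono[of 1 S] kappa_1 assms by simp
  show ?thesis
  proof (cases "s \<le> 1")
    case True
    have "dchi s - s * kappa ddchi s \<le> dchi 1 - s * kappa ddchi 1"
    proof (rule DERIV_nonneg_imp_nondecreasing[OF True])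
      fix x assume x: "s \<le> x" "x \<le> 1"
      then have "0 < x" using assms by simp
      have "((\<lambda>x. dchi x - s * kappa ddchi x) has_real_derivative ddchi x - s * (ddchi x / x)) (at x)"
        by (rule derivative_eq_intros chi_d2 kappa_has_derivative refl \<open>0 < x\<close>)+ simp
      moreover have "s * (ddchi x / x) \<le> ddchi x"
        using \<open>0 < x\<close> x chi_conv[OF \<open>0 < x\<close>] by (simp add: field_simps)
      ultimately show "\<exists>y. ((\<lambda>x. dchi x - s * kappa ddchi x) has_real_derivative y) (at x) \<and> 0 \<le> y"
        by force
    qed
    moreover have "0 \<le> dchi s" using assms by (intro dchi_nonneg)
    moreover have "kappa ddchi s \<le> 0" using kappa_mono[of s 1] kappa_1 True assms by simp
    moreover have "0 \<le> S * kappa ddchi S" using S assms by simp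
    ultimately show ?thesis by (simp add: kappa_1)
  next
    case False
    then have "0 \<le> kappa ddchi s" "kappa ddchi s \<le> kappa ddchi S"
      using kappa_mono[of 1 s] kappa_mono[of s S] kappa_1 assms by auto
    then have "s * \<bar>kappa ddchi s\<bar> \<le> S * kappa ddchi S" using assms by (intro mult_mono) auto
    moreover have "0 \<le> dchi 1" by (intro dchi_nonneg) simp
    ultimately show ?thesis by simp
  qed
qed

lemma Kfun_reaction_le:
  assumes "reaction_rates F1 F2 G1 G2 M L" and sol: "reaction_solution F1 F2 G1 G2 \<tau> s q"
    and "0 \<le> \<tau>" "1 \<le> S" and S: "s 0 * exp (2 * M * \<tau>) \<le> S"
  shows "Kfun ddchi (s \<tau>) \<le> Kfun ddchi (s 0) + 2 * M * (dchi 1 + S * kappa ddchi S) * \<tau>"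
proof -
  interpret reaction_rates F1 F2 G1 G2 M L by fact
  let ?c = "dchi 1 + S * kappa ddchi S"
  have c0: "0 \<le> ?c"
    using kappa_mono[of 1 S] kappa_1 \<open>1 \<le> S\<close> dchi_nonneg[of 1] by simp
  have s0: "0 \<le> s 0" using sol \<open>0 \<le> \<tau>\<close> by (auto simp: reaction_solution_def)
  show ?thesis
  proof (cases "s 0 = 0")
    case True
    have "0 \<le> s \<tau>" using sol \<open>0 \<le> \<tau>\<close> by (auto simp: reaction_solution_def)
    then have "s \<tau> = 0" using reaction_growth(1)[OF sol \<open>0 \<le> \<tau>\<close>] True by simp
    then show ?thesis using True c0 M_nonneg \<open>0 \<le> \<tau>\<close> by simp
  next
    case False
    show ?thesis
    proof (rule increment_le[OF \<open>0 \<le> \<tau>\<close>])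
      fix t assume t: "t \<in> {0..\<tau>}"
      note g = reaction_growth[OF reaction_solution_mono[OF sol, of t]]
      have "0 < s 0" using False s0 by simp
      also have "s 0 \<le> s t * exp (2 * M * t)" using g(2) t by simp
      finally have pos: "0 < s t" by (simp add: zero_less_mult_iff)
      have "s t \<le> s 0 * exp (2 * M * t)" using g(1) t by simp
      also have "\<dots> \<le> s 0 * exp (2 * M * \<tau>)"
        using s0 t M_nonneg by (intro mult_left_mono) (auto intro!: mult_left_mono)
      finally have le: "s t \<le> S" using S by simp
      have d: "(s has_real_derivative s t * growth (s t) (q t)) (at t within {0..\<tau>})"
        and gr: "\<bar>growth (s t) (q t)\<bar> \<le> 2 * M"
        using sol t by (auto simp: reaction_solution_def SigmaR_growth intro: abs_growth_le)
      show "((\<lambda>t. Kfun ddchi (s t)) has_real_derivative kappa ddchi (s t) * (s t * growth (s t) (q t))) (at t within {0..\<tau>})"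
        using DERIV_chain2[OF Kfun_has_derivative[OF pos] d] .
      have "kappa ddchi (s t) * (s t * growth (s t) (q t)) \<le> \<bar>growth (s t) (q t)\<bar> * (s t * \<bar>kappa ddchi (s t)\<bar>)"
        using abs_ge_self[of "kappa ddchi (s t) * (s t * growth (s t) (q t))"] pos by (simp add: abs_mult ac_simps)
      also have "\<dots> \<le> 2 * M * ?c"
        using gr mult_kappa_bounded[OF \<open>1 \<le> S\<close> pos le] pos M_nonneg by (intro mult_mono) auto
      finally show "kappa ddchi (s t) * (s t * growth (s t) (q t)) \<le> 2 * M * ?c" .
    qed
  qed
qed

end

theorem mainTheorem10:
  fixes a b T :: real
    and chi dchi ddchi :: "real \<Rightarrow> real"
    and F1 F2 G1 G2 :: "real \<Rightarrow> real \<Rightarrow> real"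
    and rho0 eta0 r0 :: "real \<Rightarrow> real"
  assumes ab: "a < b" and Tpos: "T > 0"
    and chi_cont: "continuous_on {0..} chi"
    and chi_d1: "\<And>x. x > 0 \<Longrightarrow> (chi has_real_derivative dchi x) (at x)"
    and chi_d2: "\<And>x. x > 0 \<Longrightarrow> (dchi has_real_derivative ddchi x) (at x)"
    and chi_C2: "continuous_on {0<..} ddchi"
    and chi_conv: "\<And>x. x > 0 \<Longrightarrow> ddchi x > 0"
    and chi_lim: "(dchi \<longlongrightarrow> 0) (at_right 0)"
    and kappa_ex: "\<And>x. x > 0 \<Longrightarrow> interval_lebesgue_integrable lborel 1 (ereal x) (\<lambda>s. ddchi s / s)"
    and K_ex: "\<And>\<sigma>. \<sigma> \<ge> 0 \<Longrightarrow> interval_lebesgue_integrable lborel 0 (ereal \<sigma>) (kappa ddchi)"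
    and FG_bdd: "\<exists>M. \<forall>x\<ge>0. \<forall>y\<ge>0. \<bar>F1 x y\<bar> \<le> M \<and> \<bar>F2 x y\<bar> \<le> M \<and> \<bar>G1 x y\<bar> \<le> M \<and> \<bar>G2 x y\<bar> \<le> M"
    and FG_lip: "\<exists>L. \<forall>x1\<ge>0. \<forall>y1\<ge>0. \<forall>x2\<ge>0. \<forall>y2\<ge>0.
        \<bar>F1 x1 y1 - F1 x2 y2\<bar> \<le> L * (\<bar>x1 - x2\<bar> + \<bar>y1 - y2\<bar>) \<and>
        \<bar>F2 x1 y1 - F2 x2 y2\<bar> \<le> L * (\<bar>x1 - x2\<bar> + \<bar>y1 - y2\<bar>) \<and>
        \<bar>G1 x1 y1 - G1 x2 y2\<bar> \<le> L * (\<bar>x1 - x2\<bar> + \<bar>y1 - y2\<bar>) \<and>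
        \<bar>G2 x1 y1 - G2 x2 y2\<bar> \<le> L * (\<bar>x1 - x2\<bar> + \<bar>y1 - y2\<bar>)"
    and G1_sign: "\<And>y. y \<ge> 0 \<Longrightarrow> G1 0 y \<ge> 0"
    and G2_sign: "\<And>x. x \<ge> 0 \<Longrightarrow> G2 x 0 \<ge> 0"
    and rho0_BV: "BV {a<..<b} rho0" and eta0_BV: "BV {a<..<b} eta0"
    and rho0_Linf: "\<exists>M. \<forall>x\<in>{a<..<b}. \<bar>rho0 x\<bar> \<le> M"
    and eta0_Linf: "\<exists>M. \<forall>x\<in>{a<..<b}. \<bar>eta0 x\<bar> \<le> M"
    and rho0_nn: "\<And>x. x \<in> {a<..<b} \<Longrightarrow> rho0 x \<ge> 0"
    and eta0_nn: "\<And>x. x \<in> {a<..<b} \<Longrightarrow> eta0 x \<ge> 0"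
    and r0_BV: "BV {a<..<b} r0"
    and r0_range: "\<And>x. x \<in> {a<..<b} \<Longrightarrow> 0 \<le> r0 x \<and> r0 x \<le> 1"
    and r0_ratio: "\<And>x. x \<in> {a<..<b} \<Longrightarrow> rho0 x + eta0 x > 0 \<Longrightarrow>
                      r0 x = rho0 x / (rho0 x + eta0 x)"
  shows "\<exists>c. \<forall>\<tau> N sig r sigh rh.
           0 < \<tau> \<and> \<tau> < 1 \<and> real N * \<tau> = T \<and>
           splitting_scheme {a<..<b} chi F1 F2 G1 G2 (\<lambda>x. rho0 x + eta0 x) r0 \<tau> N sig r sigh rh
           \<longrightarrow> (\<forall>n<N. Kcal {a<..<b} ddchi (sigh n) \<le> Kcal {a<..<b} ddchi (sig n) + c * \<tau>)"
proof -
  obtain M where M: "\<forall>x\<ge>0. \<forall>y\<ge>0. \<bar>F1 x y\<bar> \<le> M \<and> \<bar>F2 x y\<bar> \<le> M \<and> \<bar>G1 x y\<bar> \<le> M \<and> \<bar>G2 x y\<bar> \<le> M"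
    using FG_bdd by blast
  obtain L where L: "\<forall>x1\<ge>0. \<forall>y1\<ge>0. \<forall>x2\<ge>0. \<forall>y2\<ge>0.
        \<bar>F1 x1 y1 - F1 x2 y2\<bar> \<le> L * (\<bar>x1 - x2\<bar> + \<bar>y1 - y2\<bar>) \<and>
        \<bar>F2 x1 y1 - F2 x2 y2\<bar> \<le> L * (\<bar>x1 - x2\<bar> + \<bar>y1 - y2\<bar>) \<and>
        \<bar>G1 x1 y1 - G1 x2 y2\<bar> \<le> L * (\<bar>x1 - x2\<bar> + \<bar>y1 - y2\<bar>) \<and>
        \<bar>G2 x1 y1 - G2 x2 y2\<bar> \<le> L * (\<bar>x1 - x2\<bar> + \<bar>y1 - y2\<bar>)"
    using FG_lip by blast
  have rates: "reaction_rates F1 F2 G1 G2 M L"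
    using M L by unfold_locales blast+
  interpret reaction_rates F1 F2 G1 G2 M L by (rule rates)
  interpret entropy_density chi dchi ddchi
    using chi_cont chi_d1 chi_d2 chi_conv chi_lim chi_C2 K_ex by unfold_locales
  define \<Omega> where "\<Omega> = {a<..<b}"
  obtain B1 B2 where B: "\<forall>x\<in>\<Omega>. \<bar>rho0 x\<bar> \<le> B1" "\<forall>x\<in>\<Omega>. \<bar>eta0 x\<bar> \<le> B2"
    using rho0_Linf eta0_Linf unfolding \<Omega>_def by blast
  define S0 where "S0 = max 1 (B1 + B2)"
  have S0: "1 \<le> S0" "\<And>x. x \<in> \<Omega> \<Longrightarrow> rho0 x + eta0 x \<le> S0"
    using B by (auto simp: S0_def) (smt (verit))
  define S where "S = S0 * exp (2 * M * T)"
  have S1: "1 \<le> S"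
    unfolding S_def using S0(1) M_nonneg Tpos mult_mono[of 1 S0 1 "exp (2 * M * T)"] by simp
  define c where "c = 2 * M * (dchi 1 + S * kappa ddchi S)"
  have \<Omega>: "\<Omega> \<in> sets borel" "emeasure lborel \<Omega> < \<infinity>" "measure lborel \<Omega> = b - a"
    using ab by (auto simp: \<Omega>_def)
  have LOm_meas: "borel_measurable (restrict_space borel \<Omega>) = borel_measurable (LOm \<Omega>)"
    unfolding LOm_def by (intro measurable_cong_sets sets_restrict_space_cong) auto
  have fin: "finite_measure (LOm \<Omega>)"
    using \<Omega> by (intro finite_measureI) (auto simp: LOm_def emeasure_restrict_space space_restrict_space)

  have "Kcal \<Omega> ddchi (sigh n) \<le> Kcal \<Omega> ddchi (sig n) + c * (b - a) * \<tau>"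
    if \<tau>: "0 < \<tau>" and N: "real N * \<tau> = T" and n: "n < N"
      and scheme: "splitting_scheme \<Omega> chi F1 F2 G1 G2 (\<lambda>x. rho0 x + eta0 x) r0 \<tau> N sig r sigh rh"
    for \<tau> N sig r sigh rh n
  proof -
    let ?L = "LOm \<Omega>"
    have init: "sig 0 = (\<lambda>x. rho0 x + eta0 x)" "r 0 = r0"
      and react: "\<And>n x. n < N \<Longrightarrow> x \<in> \<Omega> \<Longrightarrow> \<exists>s q. s 0 = sig n x \<and> q 0 = r n x \<and>
        reaction_solution F1 F2 G1 G2 \<tau> s q \<and> sigh n x = s \<tau> \<and> rh n x = q \<tau>"
      using scheme unfolding splitting_scheme_def reaction_solution_def by blast+
    have inv: "n \<le> N \<Longrightarrow> sig n \<in> borel_measurable ?L \<and> r n \<in> borel_measurable ?L \<and>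
        (\<forall>x\<in>\<Omega>. 0 \<le> sig n x \<and> 0 \<le> r n x \<and> r n x \<le> 1) \<and>
        (AE x in ?L. sig n x \<le> S0 * exp (2 * M * (real n * \<tau>)))" for n
    proof (induction n)
      case 0
      have "rho0 \<in> borel_measurable ?L" "eta0 \<in> borel_measurable ?L" "r0 \<in> borel_measurable ?L"
        using rho0_BV eta0_BV r0_BV unfolding LOm_meas[symmetric] \<Omega>_def[symmetric]
        by (auto intro: BV_borel_measurable)
      then show ?case
        using rho0_nn eta0_nn r0_range S0(2) unfolding init \<Omega>_def by (auto intro!: AE_I2)
    next
      case (Suc n)
      then have n: "n < N" and meas: "sig n \<in> borel_measurable ?L" "r n \<in> borel_measurable ?L"
        and bnd: "AE x in ?L. sig n x \<le> S0 * exp (2 * M * (real n * \<tau>))" by auto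
      note step = reaction_step[OF less_imp_le[OF \<tau>] meas react[OF n], simplified]
      let ?M = "S0 * exp (2 * M * (real (Suc n) * \<tau>))"
      have bndh: "AE x in ?L. sigh n x \<le> ?M"
        using bnd AE_space
      proof eventually_elim
        case (elim x)
        then have "sigh n x \<le> sig n x * exp (2 * M * \<tau>)" using step(6)[of x] by simp
        also have "\<dots> \<le> S0 * exp (2 * M * (real n * \<tau>)) * exp (2 * M * \<tau>)"
          using elim by (intro mult_right_mono) auto
        also have "\<dots> = ?M" by (simp add: algebra_simps flip: exp_add)
        finally show ?case .
      qed
      from scheme n obtain rho eta where rho: "rho \<in> borel_measurable borel" "eta \<in> borel_measurable borel"
          "\<forall>x\<in>\<Omega>. 0 \<le> rho x \<and> 0 \<le> eta x"
        and min: "\<forall>\<mu>\<in>meas_on \<Omega> (\<integral>\<^sup>+ x \<in> \<Omega>. ennreal (rh n x * sigh n x) \<partial>lborel).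
          \<forall>\<nu>\<in>meas_on \<Omega> (\<integral>\<^sup>+ x \<in> \<Omega>. ennreal ((1 - rh n x) * sigh n x) \<partial>lborel).
          jko \<Omega> chi \<tau> (dens \<Omega> (\<lambda>x. rh n x * sigh n x)) (dens \<Omega> (\<lambda>x. (1 - rh n x) * sigh n x)) (dens \<Omega> rho) (dens \<Omega> eta)
          \<le> jko \<Omega> chi \<tau> (dens \<Omega> (\<lambda>x. rh n x * sigh n x)) (dens \<Omega> (\<lambda>x. (1 - rh n x) * sigh n x)) \<mu> \<nu>"
        and sig: "\<forall>x\<in>\<Omega>. sig (Suc n) x = rho x + eta x"
        and T: "\<exists>T. T \<in> measurable ?L ?L \<and> T ` \<Omega> \<subseteq> \<Omega> \<and> mono_on \<Omega> T \<and>
             distr (dens \<Omega> (sig (Suc n))) ?L T = dens \<Omega> (sigh n) \<and>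
             (\<integral>\<^sup>+ x. ennreal ((x - T x)^2) \<partial>dens \<Omega> (sig (Suc n)))
                = W2sq \<Omega> (dens \<Omega> (sig (Suc n))) (dens \<Omega> (sigh n)) \<and>
             (\<forall>x\<in>\<Omega>. r (Suc n) x = rh n (T x))"
        unfolding splitting_scheme_def Let_def by blast
      obtain T where T: "T \<in> measurable ?L ?L" "distr (dens \<Omega> (sig (Suc n))) ?L T = dens \<Omega> (sigh n)"
        "(\<integral>\<^sup>+ x. ennreal ((x - T x)^2) \<partial>dens \<Omega> (sig (Suc n))) = W2sq \<Omega> (dens \<Omega> (sig (Suc n))) (dens \<Omega> (sigh n))"
        "\<forall>x\<in>\<Omega>. r (Suc n) x = rh n (T x)"
        using T by blast
      have rhoL: "rho \<in> borel_measurable ?L" "eta \<in> borel_measurable ?L"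
        unfolding LOm_def using rho by (auto intro: measurable_restrict_space1)
      have dens_sig: "dens \<Omega> (sig (Suc n)) = dens \<Omega> (\<lambda>x. rho x + eta x)"
        using sig by (intro dens_cong) auto
      have "AE x in ?L. rho x + eta x \<le> ?M"
      proof (rule jko_max_principle[OF \<Omega>(1,2) \<tau> _ rhoL step(1,2)])
        show "0 < ?M" using S0(1) by simp
        show "jko \<Omega> chi \<tau> (dens \<Omega> (\<lambda>x. rh n x * sigh n x)) (dens \<Omega> (\<lambda>x. (1 - rh n x) * sigh n x)) (dens \<Omega> rho) (dens \<Omega> eta)
          \<le> jko \<Omega> chi \<tau> (dens \<Omega> (\<lambda>x. rh n x * sigh n x)) (dens \<Omega> (\<lambda>x. (1 - rh n x) * sigh n x)) \<mu> \<nu>"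
          if "\<mu> \<in> meas_on \<Omega> (\<integral>\<^sup>+x. ennreal (rh n x * sigh n x) \<partial>?L)"
            "\<nu> \<in> meas_on \<Omega> (\<integral>\<^sup>+x. ennreal ((1 - rh n x) * sigh n x) \<partial>?L)" for \<mu> \<nu>
          using min that \<Omega>(1) by (simp add: nn_integral_LOm)
      qed (use rho step bndh T dens_sig in auto)
      then have "AE x in ?L. sig (Suc n) x \<le> ?M"
        using AE_space by eventually_elim (use sig in auto)
      moreover have "sig (Suc n) \<in> borel_measurable ?L"
        using borel_measurable_add[OF rhoL] sig
        by (subst measurable_cong[where g="\<lambda>x. rho x + eta x"]) auto
      moreover have "r (Suc n) \<in> borel_measurable ?L"
        using measurable_compose[OF T(1) step(2)] T(4)
        by (subst measurable_cong[where g="\<lambda>x. rh n (T x)"]) auto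
      moreover have "T x \<in> \<Omega>" if "x \<in> \<Omega>" for x using measurable_space[OF T(1)] that by simp
      ultimately show ?case using sig rho(3) T(4) step(4,5) by auto
    qed
    have meas: "sig n \<in> borel_measurable ?L" "r n \<in> borel_measurable ?L"
      and nn: "\<And>x. x \<in> \<Omega> \<Longrightarrow> 0 \<le> sig n x"
      and bnd: "AE x in ?L. sig n x \<le> S0 * exp (2 * M * (real n * \<tau>))" using inv[of n] n by auto
    note step = reaction_step[OF less_imp_le[OF \<tau>] meas react[OF n], simplified]
    have time: "real n * \<tau> + \<tau> \<le> T"
    proof -
      have "(real n + 1) * \<tau> \<le> real N * \<tau>" using n \<tau> by (intro mult_right_mono) auto
      then show ?thesis using N by (simp add: algebra_simps)
    qed
    have le_S: "AE x in ?L. sig n x * exp (2 * M * \<tau>) \<le> S"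
      using bnd
    proof eventually_elim
      case (elim x)
      then have "sig n x * exp (2 * M * \<tau>) \<le> S0 * exp (2 * M * (real n * \<tau>)) * exp (2 * M * \<tau>)"
        by (intro mult_right_mono) auto
      also have "\<dots> = S0 * exp (2 * M * (real n * \<tau> + \<tau>))" by (simp add: algebra_simps flip: exp_add)
      also have "\<dots> \<le> S"
        unfolding S_def using S0(1) time M_nonneg by (intro mult_left_mono) (auto intro!: mult_left_mono)
      finally show ?case .
    qed
    have K_le: "AE x in ?L. Kfun ddchi (sigh n x) \<le> Kfun ddchi (sig n x) + c * \<tau>"
      using le_S AE_space
    proof eventually_elim
      case (elim x)
      then obtain s q where s: "s 0 = sig n x" "reaction_solution F1 F2 G1 G2 \<tau> s q" "sigh n x = s \<tau>"
        using react[OF n, of x] by auto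
      show ?case
        using Kfun_reaction_le[OF rates s(2) less_imp_le[OF \<tau>] S1] elim s by (simp add: c_def)
    qed
    obtain C where C: "\<And>s. 0 \<le> s \<Longrightarrow> s \<le> S \<Longrightarrow> \<bar>Kfun ddchi s\<bar> \<le> C" using Kfun_bounded by blast
    have le_sigh: "AE x in ?L. sigh n x \<le> S"
      using le_S AE_space
    proof eventually_elim
      case (elim x)
      then show ?case using step(6)[of x] by simp
    qed
    have le_sig: "AE x in ?L. sig n x \<le> S"
      using le_S AE_space
    proof eventually_elim
      case (elim x)
      have "sig n x * 1 \<le> sig n x * exp (2 * M * \<tau>)"
        using elim nn \<tau> M_nonneg by (intro mult_left_mono) auto
      then show ?case using elim by simp
    qed
    interpret finite_measure ?L by (rule fin)
    have int: "integrable ?L (\<lambda>x. Kfun ddchi (f x))"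
      if "f \<in> borel_measurable ?L" "\<And>x. x \<in> \<Omega> \<Longrightarrow> 0 \<le> f x" "AE x in ?L. f x \<le> S" for f
    proof (rule integrable_const_bound)
      show "AE x in ?L. norm (Kfun ddchi (f x)) \<le> C"
        using that(3) AE_space by eventually_elim (use C that(2) in auto)
      show "(\<lambda>x. Kfun ddchi (f x)) \<in> borel_measurable ?L"
        using that by (intro Kfun_borel_measurable) auto
    qed
    have Kcal_eq: "Kcal \<Omega> ddchi f = (\<integral>x. Kfun ddchi (f x) \<partial>?L)" for f
      using \<Omega>(1) by (simp add: Kcal_def LOm_def integral_restrict_space set_lebesgue_integral_def)
    have "Kcal \<Omega> ddchi (sigh n) \<le> (\<integral>x. Kfun ddchi (sig n x) + c * \<tau> \<partial>?L)"
      unfolding Kcal_eq using int meas step nn le_sig le_sigh K_le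
      by (intro integral_mono_AE Bochner_Integration.integrable_add) auto
    also have "\<dots> = Kcal \<Omega> ddchi (sig n) + c * \<tau> * measure ?L \<Omega>"
      unfolding Kcal_eq using int[OF meas(1) nn le_sig] by simp
    also have "measure ?L \<Omega> = b - a"
      using \<Omega> by (simp add: LOm_def measure_restrict_space)
    finally show ?thesis by (simp add: algebra_simps)
  qed
  then show ?thesis
    unfolding \<Omega>_def by (intro exI[of _ "c * (b - a)"]) blast
qed

end
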